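(* Let $k$ be a field and let $P$ be a $k$-vector space. For $\theta \in \mathrm{Bil}(P \times P, k)$ let $P_\theta$ be the algebra with underlying vector space $P \times k$ and multiplication $(p, x) \star (q, y) = (0, \theta(p, q))$ for all $p, q \in P$, $x, y \in k$. Then: (1) $\mathrm{Ext}(P_0, k_0) \cong \mathrm{Bil}(P \times P, k)$, and the equivalence classes of all metabelian algebras that are extensions of $P_0$ by $k_0$ are represented by the extensions $$0 \to k_0 \to P_\theta \to P_0 \to 0,$$ for any $\theta \in \mathrm{Bil}(P \times P, k)$, with maps $x \mapsto (0, x)$ and $(p, x) \mapsto p$. Any metabelian algebra having the derived algebra of dimension $1$ is isomorphic to $Q_\theta$ for some vector space $Q$ and some $\theta \in \mathrm{Bil}(Q \times Q, k)$. (2) Two algebras $P_\theta$ and $P_{\theta'}$ (with $\theta, \theta' \in \mathrm{Bil}(P \times P, k)$) are isomorphic if and only if the bilinear forms $\theta$ and $\theta'$ are homothetic, i.e. there exists a pair $(u, \psi) \in k^* \times \mathrm{Aut}_k(P)$ such that $$u\, \theta(p, q) = \theta'(\psi(p), \psi(q)) \qquad \text{for all } p, q \in P.$$ In particular, if $k = k^2$, then $P_\theta \cong P_{\theta'}$ if and only if $\theta$ and $\theta'$ are isometric. (3) For $\theta \in \mathrm{Bil}(P \times P, k)$, the group of algebra automorphisms $\mathrm{Aut}_{\mathrm{Alg}}(P_\theta)$ is isomorphic to $$\mathcal{G}(P, \theta) := \{ (u, \lambda, \psi) \in k^* \times P^* \times \mathrm{Aut}_k(P) \mid u\, \theta(p,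 q) = \theta(\psi(p), \psi(q)), \ \forall\, p, q \in P \},$$ where $\mathcal{G}(P, \theta)$ is a group with respect to the multiplication $$(u, \lambda, \psi) \cdot (u', \lambda', \psi') := (uu', \ \lambda \circ \psi' + u \lambda', \ \psi \circ \psi')$$ for all $(u, \lambda, \psi), (u', \lambda', \psi') \in \mathcal{G}(P, \theta)$.
   Context: All vector spaces, algebras, linear and bilinear maps are over an arbitrary field $k$; algebras are associative, not necessarily unital. $\mathrm{Bil}(P \times P, k)$ is the space of bilinear forms on $P$, $P^* = \mathrm{Hom}_k(P, k)$, $k^* = k \setminus \{0\}$, $\mathrm{Aut}_k(P)$ is the group of linear automorphisms of $P$, and $k^2 := \{x^2 \mid x \in k\}$. Two bilinear forms $\theta, \theta'$ on $P$ are isometric if there is $\varphi \in \mathrm{Aut}_k(P)$ with $\theta(p, q) = \theta'(\varphi(p), \varphi(q))$ for all $p, q \in P$. For a vector space $V$, $V_0$ denotes $V$ with the trivial multiplication $xy = 0$ (an "abelian" algebra). The derived algebra of an algebra $A$ is the linear span of all products $xy$, $x, y \in A$. An algebra $A$ is metabelian if it is an extension of an abelian algebra by an abelian algebra, where an extension of an algebra $Q$ by an algebra $W$ is a triple $(A, i, \pi)$ with $i : W \to A$, $\pi : A \to Q$ algebra morphisms such that $0 \to W \xrightarrow{i} A \xrightarrow{\pi} Q \to 0$ is exact. Two extensions $(A, i, \pi)$, $(B, j, \rho)$ of $Q$ by $W$ are equivalent if there is an algebra morphism $\varphi : A \to B$ with $\varphi \circ i = j$ and $\rho \circ \varphi =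 \pi$; $\mathrm{Ext}(Q, W)$ is the set of equivalence classes. The bijection in (1) sends $\theta$ to the class of the displayed extension.
   Formalization: In (3) the isomorphism Aut_Alg(P_θ) ≅ G(P,θ) is stated only when θ is not identically zero or P = 0; for θ = 0, P ≠ 0 it is false (k = F_2, P = k: the orders are 6 and 2). That G(P,θ) is a group is stated for all θ. *)

theory Defs
  imports "HOL-Algebra.Bij" "Jordan_Normal_Form.Missing_VectorSpace"
begin

text \<open>
  An algebra is a record of type \<^typ>\<open>('k, 'a) module\<close> whose additive and scalar part is a vector
  space over the field \<open>K\<close>. Algebras are not assumed unital: the \<open>one\<close> field of the record is never
  used. For plain vector spaces the \<open>mult\<close> field is ignored as well.
\<close>

locale assoc_algebra = vectorspace K A for K and A +
  assumes alg_m_closed: "\<lbrakk>x \<in> carrier A; y \<in> carrier A\<rbrakk> \<Longrightarrow> x \<otimes>\<^bsub>A\<^esub> y \<in> carrier A"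
    and alg_m_assoc: "\<lbrakk>x \<in> carrier A; y \<in> carrier A; z \<in> carrier A\<rbrakk>
      \<Longrightarrow> (x \<otimes>\<^bsub>A\<^esub> y) \<otimes>\<^bsub>A\<^esub> z = x \<otimes>\<^bsub>A\<^esub> (y \<otimes>\<^bsub>A\<^esub> z)"
    and alg_l_distr: "\<lbrakk>x \<in> carrier A; y \<in> carrier A; z \<in> carrier A\<rbrakk>
      \<Longrightarrow> (x \<oplus>\<^bsub>A\<^esub> y) \<otimes>\<^bsub>A\<^esub> z = (x \<otimes>\<^bsub>A\<^esub> z) \<oplus>\<^bsub>A\<^esub> (y \<otimes>\<^bsub>A\<^esub> z)"
    and alg_r_distr: "\<lbrakk>x \<in> carrier A; y \<in> carrier A; z \<in> carrier A\<rbrakk>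
      \<Longrightarrow> x \<otimes>\<^bsub>A\<^esub> (y \<oplus>\<^bsub>A\<^esub> z) = (x \<otimes>\<^bsub>A\<^esub> y) \<oplus>\<^bsub>A\<^esub> (x \<otimes>\<^bsub>A\<^esub> z)"
    and alg_smult_l: "\<lbrakk>c \<in> carrier K; x \<in> carrier A; y \<in> carrier A\<rbrakk>
      \<Longrightarrow> (c \<odot>\<^bsub>A\<^esub> x) \<otimes>\<^bsub>A\<^esub> y = c \<odot>\<^bsub>A\<^esub> (x \<otimes>\<^bsub>A\<^esub> y)"
    and alg_smult_r: "\<lbrakk>c \<in> carrier K; x \<in> carrier A; y \<in> carrier A\<rbrakk>
      \<Longrightarrow> x \<otimes>\<^bsub>A\<^esub> (c \<odot>\<^bsub>A\<^esub> y) = c \<odot>\<^bsub>A\<^esub> (x \<otimes>\<^bsub>A\<^esub> y)"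

definition alg_hom ::
  "('k, 'm) ring_scheme \<Rightarrow> ('k, 'a) module \<Rightarrow> ('k, 'b) module \<Rightarrow> ('a \<Rightarrow> 'b) set" where
  "alg_hom K A B = {f \<in> module_hom K A B.
     \<forall>x\<in>carrier A. \<forall>y\<in>carrier A. f (x \<otimes>\<^bsub>A\<^esub> y) = f x \<otimes>\<^bsub>B\<^esub> f y}"

definition alg_isomorphic ::
  "('k, 'm) ring_scheme \<Rightarrow> ('k, 'a) module \<Rightarrow> ('k, 'b) module \<Rightarrow> bool" where
  "alg_isomorphic K A B \<longleftrightarrow> (\<exists>f \<in> alg_hom K A B. bij_betw f (carrier A) (carrier B))"

definition derived_algebra :: "('k, 'm) ring_scheme \<Rightarrow> ('k, 'a) module \<Rightarrow> 'a set" where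
  "derived_algebra K A = module.span K A {x \<otimes>\<^bsub>A\<^esub> y | x y. x \<in> carrier A \<and> y \<in> carrier A}"

text \<open>The abelian algebra \<open>V\<^sub>0\<close> on a vector space \<open>V\<close>.\<close>

definition abelian_alg :: "('k, 'v) module \<Rightarrow> ('k, 'v) module" where
  "abelian_alg V = V\<lparr>mult := \<lambda>x y. \<zero>\<^bsub>V\<^esub>\<rparr>"

text \<open>The field regarded as a one-dimensional vector space over itself.\<close>

definition field_space :: "('k, 'm) ring_scheme \<Rightarrow> ('k, 'k) module" where
  "field_space K = \<lparr>carrier = carrier K, mult = mult K, one = one K, zero = zero K,
     add = add K, smult = mult K\<rparr>"


section \<open>Extensions and metabelian algebras\<close>

text \<open>\<open>(A, i, \<pi>)\<close> is an extension of \<open>Q\<close> by \<open>W\<close>: the sequence \<open>0 \<rightarrow> W \<rightarrow> A \<rightarrow> Q \<rightarrow> 0\<close> is exact.\<close>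

definition is_extension :: "('k, 'm) ring_scheme \<Rightarrow> ('k, 'q) module \<Rightarrow> ('k, 'w) module
    \<Rightarrow> ('k, 'a) module \<times> ('w \<Rightarrow> 'a) \<times> ('a \<Rightarrow> 'q) \<Rightarrow> bool" where
  "is_extension K Q W = (\<lambda>(A, i, \<pi>).
     assoc_algebra K Q \<and> assoc_algebra K W \<and> assoc_algebra K A \<and>
     i \<in> alg_hom K W A \<and> \<pi> \<in> alg_hom K A Q \<and>
     inj_on i (carrier W) \<and>
     i ` carrier W = {a \<in> carrier A. \<pi> a = \<zero>\<^bsub>Q\<^esub>} \<and>
     \<pi> ` carrier A = carrier Q)"

text \<open>The two extensions may have underlying sets in different types.\<close>

definition ext_equivalent :: "('k, 'm) ring_scheme \<Rightarrow> ('k, 'w) module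
    \<Rightarrow> ('k, 'a) module \<times> ('w \<Rightarrow> 'a) \<times> ('a \<Rightarrow> 'q)
    \<Rightarrow> ('k, 'b) module \<times> ('w \<Rightarrow> 'b) \<times> ('b \<Rightarrow> 'q) \<Rightarrow> bool" where
  "ext_equivalent K W = (\<lambda>(A, i, \<pi>) (B, j, \<rho>).
     \<exists>\<phi> \<in> alg_hom K A B.
       (\<forall>w\<in>carrier W. \<phi> (i w) = j w) \<and> (\<forall>a\<in>carrier A. \<rho> (\<phi> a) = \<pi> a))"

text \<open>
  All extensions with total algebra in the type \<^typ>\<open>'a\<close>. Maps are only relevant on the carriers:
  triples differing outside of them are equivalent, so \<open>Ext\<close> does not see the difference.
\<close>

definition ext_rel :: "('k, 'm) ring_scheme \<Rightarrow> ('k, 'q) module \<Rightarrow> ('k, 'w) module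
    \<Rightarrow> (('k, 'a) module \<times> ('w \<Rightarrow> 'a) \<times> ('a \<Rightarrow> 'q)) rel" where
  "ext_rel K Q W = {(E, F). is_extension K Q W E \<and> is_extension K Q W F \<and> ext_equivalent K W E F}"

definition Ext :: "('k, 'm) ring_scheme \<Rightarrow> ('k, 'q) module \<Rightarrow> ('k, 'w) module
    \<Rightarrow> (('k, 'a) module \<times> ('w \<Rightarrow> 'a) \<times> ('a \<Rightarrow> 'q)) set set" where
  "Ext K Q W = {E. is_extension K Q W E} // ext_rel K Q W"

text \<open>
  The types chosen for the kernel \<open>W\<close> and the quotient \<open>Q\<close> are no restriction, since up to isomorphism
  they are a subspace of \<open>A\<close> and a space of cosets in \<open>A\<close>; see \<open>metabelianI\<close> below.
\<close>

definition metabelian :: "('k, 'm) ring_scheme \<Rightarrow> ('k, 'a) module \<Rightarrow> bool" where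
  "metabelian K A \<longleftrightarrow> (\<exists>(Q :: ('k, 'a set) module) (W :: ('k, 'a) module) i \<pi>.
     vectorspace K Q \<and> vectorspace K W \<and>
     is_extension K (abelian_alg Q) (abelian_alg W) (A, i, \<pi>))"


section \<open>Bilinear forms and the algebras they define\<close>

text \<open>
  Forms, functionals and automorphisms are taken extensional (\<^const>\<open>undefined\<close> outside the carrier),
  so that equality of functions is equality of maps.
\<close>

definition Bil :: "('k, 'm) ring_scheme \<Rightarrow> ('k, 'p) module \<Rightarrow> ('p \<Rightarrow> 'p \<Rightarrow> 'k) set" where
  "Bil K P = {\<theta> \<in> carrier P \<rightarrow>\<^sub>E (carrier P \<rightarrow>\<^sub>E carrier K).
     (\<forall>p\<in>carrier P. (\<lambda>q. \<theta> p q) \<in> module_hom K P (field_space K)) \<and>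
     (\<forall>q\<in>carrier P. (\<lambda>p. \<theta> p q) \<in> module_hom K P (field_space K))}"

definition dual_space :: "('k, 'm) ring_scheme \<Rightarrow> ('k, 'p) module \<Rightarrow> ('p \<Rightarrow> 'k) set" where
  "dual_space K P = module_hom K P (field_space K) \<inter> extensional (carrier P)"

definition lin_aut :: "('k, 'm) ring_scheme \<Rightarrow> ('k, 'p) module \<Rightarrow> ('p \<Rightarrow> 'p) set" where
  "lin_aut K P = module_hom K P P \<inter> Bij (carrier P)"

definition isometric ::
  "('k, 'm) ring_scheme \<Rightarrow> ('k, 'p) module \<Rightarrow> ('p \<Rightarrow> 'p \<Rightarrow> 'k) \<Rightarrow> ('p \<Rightarrow> 'p \<Rightarrow> 'k) \<Rightarrow> bool" where
  "isometric K P \<theta> \<theta>' \<longleftrightarrow> (\<exists>\<phi> \<in> lin_aut K P.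
     \<forall>p\<in>carrier P. \<forall>q\<in>carrier P. \<theta> p q = \<theta>' (\<phi> p) (\<phi> q))"

definition homothetic ::
  "('k, 'm) ring_scheme \<Rightarrow> ('k, 'p) module \<Rightarrow> ('p \<Rightarrow> 'p \<Rightarrow> 'k) \<Rightarrow> ('p \<Rightarrow> 'p \<Rightarrow> 'k) \<Rightarrow> bool" where
  "homothetic K P \<theta> \<theta>' \<longleftrightarrow> (\<exists>u \<in> carrier K - {\<zero>\<^bsub>K\<^esub>}. \<exists>\<psi> \<in> lin_aut K P.
     \<forall>p\<in>carrier P. \<forall>q\<in>carrier P. u \<otimes>\<^bsub>K\<^esub> \<theta> p q = \<theta>' (\<psi> p) (\<psi> q))"

text \<open>The algebra \<open>P\<^sub>\<theta>\<close> on \<open>P \<times> k\<close>.\<close>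

definition form_alg ::
  "('k, 'm) ring_scheme \<Rightarrow> ('k, 'p) module \<Rightarrow> ('p \<Rightarrow> 'p \<Rightarrow> 'k) \<Rightarrow> ('k, 'p \<times> 'k) module" where
  "form_alg K P \<theta> = \<lparr>carrier = carrier P \<times> carrier K,
     mult = (\<lambda>(p, x) (q, y). (\<zero>\<^bsub>P\<^esub>, \<theta> p q)),
     one = undefined,
     zero = (\<zero>\<^bsub>P\<^esub>, \<zero>\<^bsub>K\<^esub>),
     add = (\<lambda>(p, x) (q, y). (p \<oplus>\<^bsub>P\<^esub> q, x \<oplus>\<^bsub>K\<^esub> y)),
     smult = (\<lambda>c (p, x). (c \<odot>\<^bsub>P\<^esub> p, c \<otimes>\<^bsub>K\<^esub> x))\<rparr>"

text \<open>The extension \<open>0 \<rightarrow> k\<^sub>0 \<rightarrow> P\<^sub>\<theta> \<rightarrow> P\<^sub>0 \<rightarrow> 0\<close> with its canonical maps.\<close>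

definition form_ext :: "('k, 'm) ring_scheme \<Rightarrow> ('k, 'p) module \<Rightarrow> ('p \<Rightarrow> 'p \<Rightarrow> 'k)
    \<Rightarrow> ('k, 'p \<times> 'k) module \<times> ('k \<Rightarrow> 'p \<times> 'k) \<times> ('p \<times> 'k \<Rightarrow> 'p)" where
  "form_ext K P \<theta> = (form_alg K P \<theta>, (\<lambda>x. (\<zero>\<^bsub>P\<^esub>, x)), (\<lambda>(p, x). p))"


section \<open>Automorphism groups\<close>

definition AlgAut :: "('k, 'm) ring_scheme \<Rightarrow> ('k, 'a) module \<Rightarrow> ('a \<Rightarrow> 'a) monoid" where
  "AlgAut K A = BijGroup (carrier A)\<lparr>carrier := alg_hom K A A \<inter> Bij (carrier A)\<rparr>"

definition form_group :: "('k, 'm) ring_scheme \<Rightarrow> ('k, 'p) module \<Rightarrow> ('p \<Rightarrow> 'p \<Rightarrow> 'k)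
    \<Rightarrow> ('k \<times> ('p \<Rightarrow> 'k) \<times> ('p \<Rightarrow> 'p)) monoid" where
  "form_group K P \<theta> = \<lparr>
     carrier = {(u, l, \<psi>). u \<in> carrier K - {\<zero>\<^bsub>K\<^esub>} \<and> l \<in> dual_space K P \<and> \<psi> \<in> lin_aut K P \<and>
       (\<forall>p\<in>carrier P. \<forall>q\<in>carrier P. u \<otimes>\<^bsub>K\<^esub> \<theta> p q = \<theta> (\<psi> p) (\<psi> q))},
     mult = (\<lambda>(u, l, \<psi>) (u', l', \<psi>').
       (u \<otimes>\<^bsub>K\<^esub> u',
        \<lambda>p\<in>carrier P. l (\<psi>' p) \<oplus>\<^bsub>K\<^esub> u \<otimes>\<^bsub>K\<^esub> l' p,
        compose (carrier P) \<psi> \<psi>')),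
     one = (\<one>\<^bsub>K\<^esub>, \<lambda>p\<in>carrier P. \<zero>\<^bsub>K\<^esub>, \<lambda>p\<in>carrier P. p)\<rparr>"


section \<open>Independence of the types in the definition of metabelian algebras\<close>

lemma abelian_alg_simps:
  "carrier (abelian_alg V) = carrier V" "\<zero>\<^bsub>abelian_alg V\<^esub> = \<zero>\<^bsub>V\<^esub>"
  by (simp_all add: abelian_alg_def)

lemma assoc_abelian_alg:
  assumes "vectorspace K V"
  shows "assoc_algebra K (abelian_alg V)"
proof -
  interpret V: vectorspace K V by fact
  have neg: "\<exists>w\<in>carrier V. v \<oplus>\<^bsub>V\<^esub> w = \<zero>\<^bsub>V\<^esub>" if "v \<in> carrier V" for v
    using that V.module.M.r_neg V.module.M.a_inv_closed by blast
  have "module K (abelian_alg V)"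
    by (rule module_criteria)
      (auto simp: abelian_alg_def V.module.M.a_ac V.module.smult_r_distr V.module.smult_l_distr
        V.module.smult_assoc1 neg V.module.R.is_cring)
  then have "vectorspace K (abelian_alg V)"
    by (simp add: vectorspace_def V.field.field_axioms)
  then show ?thesis
    by (intro assoc_algebra.intro assoc_algebra_axioms.intro) (auto simp: abelian_alg_def)
qed

lemma alg_hom_comp:
  assumes "f \<in> alg_hom K A B" and "g \<in> alg_hom K B C"
  shows "g \<circ> f \<in> alg_hom K A C"
  using assms by (auto simp: alg_hom_def module_hom_def Pi_iff)

lemma vectorspace_transport:
  fixes g :: "'v \<Rightarrow> 'w" and V :: "('k, 'v) module"
  assumes "vectorspace K V" and inj: "inj_on g (carrier V)"
  obtains V' :: "('k, 'w) module" where "vectorspace K V'" "carrier V' = g ` carrier V"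
    "g \<in> alg_hom K (abelian_alg V) (abelian_alg V')"
    "inv_into (carrier V) g \<in> alg_hom K (abelian_alg V') (abelian_alg V)"
    "\<zero>\<^bsub>V'\<^esub> = g \<zero>\<^bsub>V\<^esub>"
proof -
  interpret V: vectorspace K V by fact
  define h where "h = inv_into (carrier V) g"
  have hg [simp]: "h (g v) = v" if "v \<in> carrier V" for v
    using that inj by (simp add: h_def)
  define V' :: "('k, 'w) module" where
    "V' = \<lparr>carrier = g ` carrier V, mult = undefined, one = undefined, zero = g \<zero>\<^bsub>V\<^esub>,
       add = (\<lambda>x y. g (h x \<oplus>\<^bsub>V\<^esub> h y)), smult = (\<lambda>c x. g (c \<odot>\<^bsub>V\<^esub> h x))\<rparr>"
  have neg: "\<exists>w\<in>carrier V. g (v \<oplus>\<^bsub>V\<^esub> w) = g \<zero>\<^bsub>V\<^esub>" if "v \<in> carrier V" for v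
    using that V.module.M.r_neg V.module.M.a_inv_closed by metis
  have "module K V'"
    by (rule module_criteria)
      (auto simp: V'_def V.module.M.a_ac V.module.smult_r_distr V.module.smult_l_distr
        V.module.smult_assoc1 neg V.module.R.is_cring)
  then have "vectorspace K V'"
    by (simp add: vectorspace_def V.field.field_axioms)
  moreover have "g \<in> alg_hom K (abelian_alg V) (abelian_alg V')"
    by (auto simp: alg_hom_def module_hom_def abelian_alg_def V'_def)
  moreover have "h \<in> alg_hom K (abelian_alg V') (abelian_alg V)"
    by (auto simp: alg_hom_def module_hom_def abelian_alg_def V'_def)
  ultimately show thesis
    using that [of V'] by (simp add: V'_def h_def)
qed

text \<open>An algebra is metabelian as soon as it is such an extension with \<open>Q\<close> and \<open>W\<close> in any types.\<close>

lemma metabelianI: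
  fixes A :: "('k, 'a) module" and Q :: "('k, 'q) module" and W :: "('k, 'w) module"
  assumes "vectorspace K Q" and "vectorspace K W"
    and ext: "is_extension K (abelian_alg Q) (abelian_alg W) (A, i, \<pi>)"
  shows "metabelian K A"
proof -
  interpret Q: vectorspace K Q by fact
  have e: "assoc_algebra K A" "i \<in> alg_hom K (abelian_alg W) A" "\<pi> \<in> alg_hom K A (abelian_alg Q)"
    "inj_on i (carrier W)" "i ` carrier W = {a \<in> carrier A. \<pi> a = \<zero>\<^bsub>Q\<^esub>}" "\<pi> ` carrier A = carrier Q"
    using ext unfolding is_extension_def prod.case abelian_alg_simps
    by - (elim conjE; assumption)+
  define g where "g = (\<lambda>q. {a \<in> carrier A. \<pi> a = q})"
  have g: "inj_on g (carrier Q)"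
  proof (rule inj_onI)
    fix q q' assume q: "q \<in> carrier Q" and eq: "g q = g q'"
    from q obtain a where a: "q = \<pi> a" "a \<in> carrier A"
      unfolding e(6) [symmetric] by (rule imageE)
    then have "a \<in> g q" by (simp add: g_def)
    then have "a \<in> g q'" by (simp only: eq)
    then show "q = q'" using a(1) by (simp add: g_def)
  qed
  obtain Q' :: "('k, 'a set) module" where Q': "vectorspace K Q'" "carrier Q' = g ` carrier Q"
    "g \<in> alg_hom K (abelian_alg Q) (abelian_alg Q')" "\<zero>\<^bsub>Q'\<^esub> = g \<zero>\<^bsub>Q\<^esub>"
    by (rule vectorspace_transport [OF assms(1) g])
  obtain W' :: "('k, 'a) module" where W': "vectorspace K W'" "carrier W' = i ` carrier W"
    "inv_into (carrier W) i \<in> alg_hom K (abelian_alg W') (abelian_alg W)"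
    by (rule vectorspace_transport [OF assms(2) e(4)])
  define j where "j = i \<circ> inv_into (carrier W) i"
  have j: "j x = x" if "x \<in> carrier W'" for x
    using that W'(2) by (simp add: j_def f_inv_into_f)
  have jW: "inj_on j (carrier W')" "j ` carrier W' = carrier W'"
    using j by (auto simp: inj_on_def image_iff)
  have "g (\<pi> a) = g \<zero>\<^bsub>Q\<^esub> \<longleftrightarrow> \<pi> a = \<zero>\<^bsub>Q\<^esub>" if "a \<in> carrier A" for a
  proof -
    have "\<pi> a \<in> carrier Q"
      using imageI [OF that, of \<pi>] by (simp only: e(6))
    then show ?thesis
      using inj_on_eq_iff [OF g] Q.module.M.zero_closed by simp
  qed
  then have "carrier W' = {a \<in> carrier A. (g \<circ> \<pi>) a = \<zero>\<^bsub>Q'\<^esub>}"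
    using e(5) by (auto simp: W'(2) Q'(4))
  moreover have "(g \<circ> \<pi>) ` carrier A = carrier Q'"
    by (simp only: image_comp [symmetric] e(6) Q'(2))
  moreover have "j \<in> alg_hom K (abelian_alg W') A"
    unfolding j_def using W'(3) e(2) by (rule alg_hom_comp)
  moreover have "g \<circ> \<pi> \<in> alg_hom K A (abelian_alg Q')"
    using e(3) Q'(3) by (rule alg_hom_comp)
  ultimately have "is_extension K (abelian_alg Q') (abelian_alg W') (A, j, g \<circ> \<pi>)"
    using e(1) jW assoc_abelian_alg [OF Q'(1)] assoc_abelian_alg [OF W'(1)]
    by (simp add: is_extension_def abelian_alg_simps)
  with Q'(1) W'(1) show ?thesis
    unfolding metabelian_def by (intro exI conjI)
qed

end

theory Submission
  imports Defs
begin

text \<open>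
  Write \<open>t = i 1\<close> for the generator of the kernel of an extension \<open>A\<close> of \<open>P\<^sub>0\<close> by \<open>k\<^sub>0\<close>. For \<open>a \<in> A\<close> both
  \<open>a t\<close> and \<open>t a\<close> are multiples of \<open>t\<close>, and by associativity the square of either factor vanishes,
  because \<open>a\<^sup>2\<close> lies in the kernel, which has zero multiplication. Hence the kernel annihilates \<open>A\<close>, so
  the product of \<open>A\<close> depends only on classes in \<open>P\<close>; computed on a linear section of \<open>A \<rightarrow> P\<close> it is the
  form \<open>\<theta>\<close>, which is therefore independent of the section. A metabelian algebra with
  one-dimensional derived algebra \<open>D\<close> is such an extension of \<open>A/D\<close>, realised on a complement of \<open>D\<close>.

  If \<open>\<theta> \<noteq> 0\<close>, the derived algebra of \<open>P\<^sub>\<theta>\<close> is \<open>0 \<times> k\<close>, so every isomorphism \<open>P\<^sub>\<theta> \<rightarrow> P\<^sub>\<theta>\<^sub>'\<close> preserves it and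
  has the triangular form \<open>(p, x) \<mapsto> (\<psi> p, \<lambda> p + u x)\<close>. Multiplicativity is then the homothety condition
  and composition of triangular maps is the group law of \<open>\<G>(P, \<theta>)\<close>.
\<close>

section \<open>Complements in vector spaces\<close>

lemma (in vectorspace) line_submodule:
  assumes "v \<in> carrier V"
  shows "submodule K ((\<lambda>c. c \<odot>\<^bsub>V\<^esub> v) ` carrier K) V"
proof (rule submodule.intro)
  show "module K V" ..
  show "(\<lambda>c. c \<odot>\<^bsub>V\<^esub> v) ` carrier K \<subseteq> carrier V"
    using assms by auto
  show "\<zero>\<^bsub>V\<^esub> \<in> (\<lambda>c. c \<odot>\<^bsub>V\<^esub> v) ` carrier K"
    using assms by (force intro: image_eqI [of _ _ "\<zero>\<^bsub>K\<^esub>"])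
next
  fix a b assume "a \<in> (\<lambda>c. c \<odot>\<^bsub>V\<^esub> v) ` carrier K" "b \<in> (\<lambda>c. c \<odot>\<^bsub>V\<^esub> v) ` carrier K"
  then show "a \<oplus>\<^bsub>V\<^esub> b \<in> (\<lambda>c. c \<odot>\<^bsub>V\<^esub> v) ` carrier K"
    using assms by (auto simp: smult_l_distr [symmetric])
next
  fix a b assume "a \<in> carrier K" "b \<in> (\<lambda>c. c \<odot>\<^bsub>V\<^esub> v) ` carrier K"
  then show "a \<odot>\<^bsub>V\<^esub> b \<in> (\<lambda>c. c \<odot>\<^bsub>V\<^esub> v) ` carrier K"
    using assms by (auto simp: smult_assoc1 [symmetric])
qed

text \<open>Zorn's lemma provides a submodule \<open>U\<close> that is maximal among those meeting
  \<open>W\<close> only in zero. If a vector \<open>v\<close> were outside \<open>U + W\<close>,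
  adding the line of \<open>v\<close> to \<open>U\<close> would give a larger submodule of the same
  kind. The argument works in any dimension.\<close>

lemma (in vectorspace) exists_complement:
  assumes W: "submodule K W V"
  obtains U where "submodule K U V" "U \<inter> W = {\<zero>\<^bsub>V\<^esub>}"
    "\<And>v. v \<in> carrier V \<Longrightarrow> \<exists>u\<in>U. \<exists>w\<in>W. v = u \<oplus>\<^bsub>V\<^esub> w"
proof -
  interpret W: LinearCombinations.submodule K W V by fact
  let ?F = "{U. submodule K U V \<and> U \<inter> W = {\<zero>\<^bsub>V\<^esub>}}"
  have "\<exists>M\<in>?F. \<forall>X\<in>?F. M \<subseteq> X \<longrightarrow> X = M"
  proof (rule subset_Zorn_nonempty)
    have "submodule K {\<zero>\<^bsub>V\<^esub>} V"
      by (rule submodule.intro) (auto intro: module_axioms)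
    then have "{\<zero>\<^bsub>V\<^esub>} \<in> ?F"
      by simp
    then show "?F \<noteq> {}" by blast
  next
    fix C assume C: "C \<noteq> {}" "subset.chain ?F C"
    have "submodule K (\<Union>C) V"
    proof (rule nested_union_vs [of C "\<lambda>X. X"])
      fix X Y assume "X \<in> C" "Y \<in> C"
      moreover have "X \<subseteq> Y \<or> Y \<subseteq> X"
        using C(2) calculation by (simp add: subset_chain_def)
      ultimately show "\<exists>Z. Z \<in> C \<and> X \<subseteq> Z \<and> Y \<subseteq> Z"
        by (elim disjE) (rule exI, intro conjI; assumption?; rule order_refl)+
    qed (use C in \<open>auto simp: subset_chain_def\<close>)
    moreover have "\<Union>C \<inter> W = {\<zero>\<^bsub>V\<^esub>}"
    proof -
      have "X \<inter> W = {\<zero>\<^bsub>V\<^esub>}" if "X \<in> C" for X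
        using that C(2) by (auto simp: subset_chain_def)
      then show ?thesis using C(1) by auto
    qed
    ultimately show "\<Union>C \<in> ?F" by simp
  qed
  then obtain U where U: "submodule K U V" "U \<inter> W = {\<zero>\<^bsub>V\<^esub>}"
    and max: "\<And>X. submodule K X V \<Longrightarrow> X \<inter> W = {\<zero>\<^bsub>V\<^esub>} \<Longrightarrow> U \<subseteq> X \<Longrightarrow> X = U"
    by auto
  interpret U: LinearCombinations.submodule K U V by fact
  have "\<exists>u\<in>U. \<exists>w\<in>W. v = u \<oplus>\<^bsub>V\<^esub> w" if v: "v \<in> carrier V" for v
  proof (rule ccontr)
    assume no: "\<not> ?thesis"
    let ?L = "(\<lambda>c. c \<odot>\<^bsub>V\<^esub> v) ` carrier K"
    let ?X = "submodule_sum U ?L"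
    have L: "submodule K ?L V"
      using v by (rule line_submodule)
    have X: "submodule K ?X V" "U \<subseteq> ?X" "?L \<subseteq> ?X"
      using U(1) L by (auto intro: sum_is_submodule dest: in_sum)
        (metis in_sum msum_comm subsetD image_eqI)
    interpret X: LinearCombinations.submodule K ?X V by (rule X(1))
    \<comment> \<open>Write \<open>x = u + c v\<close> for an element of the enlarged submodule that
      lies in \<open>W\<close>. For \<open>c = 0\<close> it lies in \<open>U \<inter> W\<close>; for
      \<open>c \<noteq> 0\<close> the equation can be solved for \<open>v\<close>, which would put
      \<open>v\<close> into \<open>U + W\<close> and contradict \<open>no\<close>.\<close>
    have "x = \<zero>\<^bsub>V\<^esub>" if x: "x \<in> ?X" "x \<in> W" for x
    proof -
      obtain u c where u: "u \<in> U" and c: "c \<in> carrier K" and eq: "x = u \<oplus>\<^bsub>V\<^esub> c \<odot>\<^bsub>V\<^esub> v"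
        using x(1) by (auto simp: submodule_sum_def)
      have uV: "u \<in> carrier V" and xV: "x \<in> carrier V"
        using u x(2) U.subset W.subset by auto
      show ?thesis
      proof (cases "c = \<zero>\<^bsub>K\<^esub>")
        case True
        then have "x = u" using eq v uV by simp
        then show ?thesis using u x(2) U(2) by auto
      next
        case False
        then have ic: "inv\<^bsub>K\<^esub> c \<in> carrier K" "inv\<^bsub>K\<^esub> c \<otimes>\<^bsub>K\<^esub> c = \<one>\<^bsub>K\<^esub>"
          using c by (auto simp: field_Units)
        have "c \<odot>\<^bsub>V\<^esub> v = \<ominus>\<^bsub>V\<^esub> u \<oplus>\<^bsub>V\<^esub> x"
          using eq uV c v by (simp add: M.r_neg1 M.r_neg2)
        \<comment> \<open>Closure of a submodule is available for sums and scalar multiples, so the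
          negative of \<open>u\<close> is written as its multiple by minus one before dividing by
          \<open>c\<close>.\<close>
        then have "inv\<^bsub>K\<^esub> c \<odot>\<^bsub>V\<^esub> (c \<odot>\<^bsub>V\<^esub> v) = inv\<^bsub>K\<^esub> c \<odot>\<^bsub>V\<^esub> (\<ominus>\<^bsub>K\<^esub> \<one>\<^bsub>K\<^esub> \<odot>\<^bsub>V\<^esub> u) \<oplus>\<^bsub>V\<^esub> inv\<^bsub>K\<^esub> c \<odot>\<^bsub>V\<^esub> x"
          using ic uV xV by (simp add: smult_r_distr smult_l_minus)
        then have "v = inv\<^bsub>K\<^esub> c \<odot>\<^bsub>V\<^esub> (\<ominus>\<^bsub>K\<^esub> \<one>\<^bsub>K\<^esub> \<odot>\<^bsub>V\<^esub> u) \<oplus>\<^bsub>V\<^esub> inv\<^bsub>K\<^esub> c \<odot>\<^bsub>V\<^esub> x"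
          using ic c v by (simp add: smult_assoc1 [symmetric])
        moreover have "inv\<^bsub>K\<^esub> c \<odot>\<^bsub>V\<^esub> (\<ominus>\<^bsub>K\<^esub> \<one>\<^bsub>K\<^esub> \<odot>\<^bsub>V\<^esub> u) \<in> U" "inv\<^bsub>K\<^esub> c \<odot>\<^bsub>V\<^esub> x \<in> W"
          using ic u x(2) by auto
        ultimately show ?thesis using no by blast
      qed
    qed
    then have "?X \<inter> W = {\<zero>\<^bsub>V\<^esub>}" by auto
    then have "?X = U" using max X by blast
    moreover have "v \<in> ?L" using v by (force intro: image_eqI [of _ _ "\<one>\<^bsub>K\<^esub>"])
    ultimately have "v \<in> U" using X(3) by auto
    moreover have "v = v \<oplus>\<^bsub>V\<^esub> \<zero>\<^bsub>V\<^esub>" using v by simp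
    ultimately show False using no W.zero_closed by blast
  qed
  with U show thesis by (rule that)
qed

text \<open>By \<open>onto\<close> and \<open>inj\<close>, the map \<open>\<pi>\<close> sends a
  complement \<open>U\<close> of its kernel bijectively onto \<open>Q\<close>; the section is the
  inverse of this restriction.\<close>

lemma linear_section:
  assumes "vectorspace K A" "vectorspace K Q"
    and hom: "\<pi> \<in> module_hom K A Q" and surj: "\<pi> ` carrier A = carrier Q"
  obtains s where "s \<in> module_hom K Q A" "\<And>q. q \<in> carrier Q \<Longrightarrow> \<pi> (s q) = q"
proof -
  interpret linear_map K A Q \<pi>
    using assms by (simp add: linear_map_def mod_hom_def mod_hom_axioms_def vectorspace.axioms)
  obtain U where U: "submodule K U A" "U \<inter> ker = {\<zero>\<^bsub>A\<^esub>}"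
    and dec: "\<And>a. a \<in> carrier A \<Longrightarrow> \<exists>u\<in>U. \<exists>w\<in>ker. a = u \<oplus>\<^bsub>A\<^esub> w"
    using V.exists_complement [OF ker_is_submodule] by metis
  interpret U: LinearCombinations.submodule K U A by fact
  have UA: "u \<in> carrier A" if "u \<in> U" for u
    using that U.subset by auto
  have onto: "\<exists>u\<in>U. \<pi> u = q" if q: "q \<in> carrier Q" for q
  proof -
    obtain a where "a \<in> carrier A" "q = \<pi> a"
      using q unfolding surj [symmetric] by blast
    moreover obtain u w where "u \<in> U" "w \<in> ker" "a = u \<oplus>\<^bsub>A\<^esub> w"
      using dec calculation(1) by blast
    ultimately have "\<pi> u = q" by (simp add: ker_def UA)
    with \<open>u \<in> U\<close> show ?thesis by blast
  qed
  have inj: "u = u'" if u: "u \<in> U" "u' \<in> U" "\<pi> u = \<pi> u'" for u u'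
  proof -
    have "u \<oplus>\<^bsub>A\<^esub> (\<ominus>\<^bsub>K\<^esub> \<one>\<^bsub>K\<^esub> \<odot>\<^bsub>A\<^esub> u') \<in> U" using u by auto
    then have "u \<ominus>\<^bsub>A\<^esub> u' \<in> U"
      using u UA by (simp add: V.module.smult_l_minus a_minus_def)
    moreover have "u \<ominus>\<^bsub>A\<^esub> u' \<in> ker"
      using u UA by (simp add: ker_def a_minus_def W.module.M.r_neg)
    ultimately have "u \<ominus>\<^bsub>A\<^esub> u' = \<zero>\<^bsub>A\<^esub>" using U(2) by blast
    then show ?thesis using u UA by simp
  qed
  define s where "s q = (SOME u. u \<in> U \<and> \<pi> u = q)" for q
  have s: "s q \<in> U" "\<pi> (s q) = q" if "q \<in> carrier Q" for q
    using someI_ex [of "\<lambda>u. u \<in> U \<and> \<pi> u = q"] onto [OF that] by (auto simp: s_def)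
  \<comment> \<open>The two sides of each linearity identity lie in \<open>U\<close> and have the
    same image under \<open>\<pi>\<close>, so \<open>inj\<close> identifies them.\<close>
  have "s \<in> module_hom K Q A"
    unfolding module_hom_def
    by (auto intro!: inj simp: s UA)
  with s(2) show thesis by (rule that [rotated]) 
qed

section \<open>Extensions and the algebras of bilinear forms\<close>

lemma field_space_simps [simp]:
  "carrier (field_space K) = carrier K" "zero (field_space K) = zero K"
  "add (field_space K) = add K" "smult (field_space K) = mult K"
  by (simp_all add: field_space_def)

lemmas [simp] = abelian_alg_simps

lemma abelian_alg_ops [simp]:
  "add (abelian_alg V) = add V" "smult (abelian_alg V) = smult V"
  "mult (abelian_alg V) = (\<lambda>x y. \<zero>\<^bsub>V\<^esub>)"
  by (simp_all add: abelian_alg_def)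

lemma form_alg_simps [simp]:
  "carrier (form_alg K P \<theta>) = carrier P \<times> carrier K"
  "zero (form_alg K P \<theta>) = (\<zero>\<^bsub>P\<^esub>, \<zero>\<^bsub>K\<^esub>)"
  "(p, x) \<oplus>\<^bsub>form_alg K P \<theta>\<^esub> (q, y) = (p \<oplus>\<^bsub>P\<^esub> q, x \<oplus>\<^bsub>K\<^esub> y)"
  "c \<odot>\<^bsub>form_alg K P \<theta>\<^esub> (p, x) = (c \<odot>\<^bsub>P\<^esub> p, c \<otimes>\<^bsub>K\<^esub> x)"
  "(p, x) \<otimes>\<^bsub>form_alg K P \<theta>\<^esub> (q, y) = (\<zero>\<^bsub>P\<^esub>, \<theta> p q)"
  by (simp_all add: form_alg_def)

lemma vectorspace_field_space:
  assumes "field K"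
  shows "vectorspace K (field_space K)"
proof -
  interpret field K by fact
  show ?thesis
    by (rule vs_criteria)
      (auto simp: assms a_ac m_assoc l_distr r_distr intro!: bexI [of _ "\<ominus>\<^bsub>K\<^esub> _"] r_neg)
qed

section \<open>Linear maps and algebra morphisms between arbitrary carriers\<close>

lemma module_homI:
  assumes "\<And>x. x \<in> carrier A \<Longrightarrow> f x \<in> carrier B"
    and "\<And>x y. x \<in> carrier A \<Longrightarrow> y \<in> carrier A \<Longrightarrow> f (x \<oplus>\<^bsub>A\<^esub> y) = f x \<oplus>\<^bsub>B\<^esub> f y"
    and "\<And>c x. c \<in> carrier K \<Longrightarrow> x \<in> carrier A \<Longrightarrow> f (c \<odot>\<^bsub>A\<^esub> x) = c \<odot>\<^bsub>B\<^esub> f x"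
  shows "f \<in> module_hom K A B"
  using assms by (simp add: module_hom_def)

lemma module_hom_in: "f \<in> module_hom K A B \<Longrightarrow> x \<in> carrier A \<Longrightarrow> f x \<in> carrier B"
  using module_hom_closed by blast

lemma module_hom_zero:
  assumes "module K A" "module K B" "f \<in> module_hom K A B"
  shows "f \<zero>\<^bsub>A\<^esub> = \<zero>\<^bsub>B\<^esub>"
proof -
  interpret mod_hom K A B f
    using assms by (simp add: mod_hom_def mod_hom_axioms_def)
  show ?thesis by (rule f0_is_0)
qed

lemma module_hom_minus:
  assumes "module K A" "module K B" "f \<in> module_hom K A B" "x \<in> carrier A" "y \<in> carrier A"
  shows "f (x \<ominus>\<^bsub>A\<^esub> y) = f x \<ominus>\<^bsub>B\<^esub> f y"
proof -
  interpret mod_hom K A B f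
    using assms by (simp add: mod_hom_def mod_hom_axioms_def)
  show ?thesis using assms(4,5) by (rule f_minus)
qed

lemma module_hom_inv_into:
  assumes "module K A" and f: "f \<in> module_hom K A B" "bij_betw f (carrier A) (carrier B)"
  shows "inv_into (carrier A) f \<in> module_hom K B A"
proof -
  interpret module K A by fact
  let ?g = "inv_into (carrier A) f"
  have inj: "inj_on f (carrier A)"
    using f(2) by (simp add: bij_betw_def)
  have g: "?g y \<in> carrier A" "f (?g y) = y" if "y \<in> carrier B" for y
    using that f(2) by (auto simp: bij_betw_def inv_into_into f_inv_into_f)
  show ?thesis
  proof (rule module_homI)
    fix x y assume xy: "x \<in> carrier B" "y \<in> carrier B"
    have "x \<oplus>\<^bsub>B\<^esub> y = f (?g x \<oplus>\<^bsub>A\<^esub> ?g y)"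
      using f(1) xy by (simp add: module_hom_add g)
    then show "?g (x \<oplus>\<^bsub>B\<^esub> y) = ?g x \<oplus>\<^bsub>A\<^esub> ?g y"
      using inj xy by (simp add: g)
  next
    fix c x assume cx: "c \<in> carrier K" "x \<in> carrier B"
    have "c \<odot>\<^bsub>B\<^esub> x = f (c \<odot>\<^bsub>A\<^esub> ?g x)"
      using f(1) cx by (simp add: module_hom_smult g)
    then show "?g (c \<odot>\<^bsub>B\<^esub> x) = c \<odot>\<^bsub>A\<^esub> ?g x"
      using inj cx by (simp add: g)
  qed (rule g)
qed

lemma alg_homI:
  assumes "f \<in> module_hom K A B"
    and "\<And>x y. x \<in> carrier A \<Longrightarrow> y \<in> carrier A \<Longrightarrow> f (x \<otimes>\<^bsub>A\<^esub> y) = f x \<otimes>\<^bsub>B\<^esub> f y"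
  shows "f \<in> alg_hom K A B"
  using assms by (simp add: alg_hom_def)

lemma alg_homD:
  assumes "f \<in> alg_hom K A B"
  shows "f \<in> module_hom K A B"
    and "\<And>x. x \<in> carrier A \<Longrightarrow> f x \<in> carrier B"
    and "\<And>x y. x \<in> carrier A \<Longrightarrow> y \<in> carrier A \<Longrightarrow> f (x \<oplus>\<^bsub>A\<^esub> y) = f x \<oplus>\<^bsub>B\<^esub> f y"
    and "\<And>c x. c \<in> carrier K \<Longrightarrow> x \<in> carrier A \<Longrightarrow> f (c \<odot>\<^bsub>A\<^esub> x) = c \<odot>\<^bsub>B\<^esub> f x"
    and "\<And>x y. x \<in> carrier A \<Longrightarrow> y \<in> carrier A \<Longrightarrow> f (x \<otimes>\<^bsub>A\<^esub> y) = f x \<otimes>\<^bsub>B\<^esub> f y"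
  using assms unfolding alg_hom_def
  by (auto simp: module_hom_add module_hom_smult module_hom_in)

lemma alg_hom_inv_into:
  assumes A: "assoc_algebra K A" and f: "f \<in> alg_hom K A B" "bij_betw f (carrier A) (carrier B)"
  shows "inv_into (carrier A) f \<in> alg_hom K B A"
proof (rule alg_homI)
  interpret A: assoc_algebra K A by fact
  let ?g = "inv_into (carrier A) f"
  show "?g \<in> module_hom K B A"
    using f by (intro module_hom_inv_into alg_homD(1) A.module.module_axioms)
  have inj: "inj_on f (carrier A)"
    using f(2) by (simp add: bij_betw_def)
  have g: "?g y \<in> carrier A" "f (?g y) = y" if "y \<in> carrier B" for y
    using that f(2) by (auto simp: bij_betw_def inv_into_into f_inv_into_f)
  fix x y assume xy: "x \<in> carrier B" "y \<in> carrier B"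
  have "x \<otimes>\<^bsub>B\<^esub> y = f (?g x \<otimes>\<^bsub>A\<^esub> ?g y)"
    using f(1) xy by (simp add: alg_homD g)
  then show "?g (x \<otimes>\<^bsub>B\<^esub> y) = ?g x \<otimes>\<^bsub>A\<^esub> ?g y"
    using inj xy by (simp add: g A.alg_m_closed)
qed

lemma alg_isomorphic_sym:
  assumes "assoc_algebra K A" "alg_isomorphic K A B"
  shows "alg_isomorphic K B A"
  using assms unfolding alg_isomorphic_def by (metis alg_hom_inv_into bij_betw_inv_into)

section \<open>Equivalence of extensions\<close>

lemma is_extensionD:
  assumes "is_extension K Q W (A, i, \<pi>)"
  shows "assoc_algebra K Q" "assoc_algebra K W" "assoc_algebra K A"
    "i \<in> alg_hom K W A" "\<pi> \<in> alg_hom K A Q" "inj_on i (carrier W)"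
    "i ` carrier W = {a \<in> carrier A. \<pi> a = \<zero>\<^bsub>Q\<^esub>}" "\<pi> ` carrier A = carrier Q"
  using assms unfolding is_extension_def by simp_all

text \<open>The short five lemma.\<close>

lemma ext_equivalent_bij:
  assumes A: "is_extension K Q W (A, i, \<pi>)" and B: "is_extension K Q W (B, j, \<rho>)"
    and \<phi>: "\<phi> \<in> alg_hom K A B"
    and \<phi>i: "\<And>w. w \<in> carrier W \<Longrightarrow> \<phi> (i w) = j w"
    and \<rho>\<phi>: "\<And>a. a \<in> carrier A \<Longrightarrow> \<rho> (\<phi> a) = \<pi> a"
  shows "bij_betw \<phi> (carrier A) (carrier B)"
proof -
  note a = is_extensionD [OF A] and b = is_extensionD [OF B]
  interpret A: assoc_algebra K A by (rule a)
  interpret B: assoc_algebra K B by (rule b)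
  have mod: "module K Q" "module K W" "module K A" "module K B"
    using a(1-3) b(3) by (simp_all add: assoc_algebra_def vectorspace_def)
  interpret W: module K W by (rule mod)
  note lin = alg_homD(1) [OF \<phi>] alg_homD(1) [OF a(4)] alg_homD(1) [OF b(4)] alg_homD(1) [OF b(5)]
  note \<phi>_closed = alg_homD(2) [OF \<phi>]
  have i: "i w \<in> carrier A" if "w \<in> carrier W" for w
    using that alg_homD(2) [OF a(4)] by simp
  have i0: "i \<zero>\<^bsub>W\<^esub> = \<zero>\<^bsub>A\<^esub>" and j0: "j \<zero>\<^bsub>W\<^esub> = \<zero>\<^bsub>B\<^esub>"
    using lin mod by (simp_all add: module_hom_zero)
  \<comment> \<open>An element killed by \<open>\<phi>\<close> is killed by \<open>\<pi>\<close>,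
    since \<open>\<rho> \<circ> \<phi> = \<pi>\<close>. It therefore comes from \<open>W\<close>, on
    which \<open>\<phi>\<close> restricts to the injective map \<open>j\<close>.\<close>
  have ker: "a = \<zero>\<^bsub>A\<^esub>" if "a \<in> carrier A" "\<phi> a = \<zero>\<^bsub>B\<^esub>" for a
  proof -
    have "\<pi> a = \<zero>\<^bsub>Q\<^esub>"
      using \<rho>\<phi> [OF that(1)] that(2) module_hom_zero [OF mod(4,1) lin(4)] by simp
    then have "a \<in> i ` carrier W"
      using that(1) by (simp add: a(7))
    then obtain w where w: "w \<in> carrier W" "a = i w"
      by (auto elim: imageE)
    then have "j w = j \<zero>\<^bsub>W\<^esub>"
      using that(2) \<phi>i j0 by simp
    then have "w = \<zero>\<^bsub>W\<^esub>"
      using b(6) w(1) by (simp add: inj_on_def)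
    then show ?thesis using w i0 by simp
  qed
  have "inj_on \<phi> (carrier A)"
  proof (rule inj_onI)
    fix x y assume xy: "x \<in> carrier A" "y \<in> carrier A" "\<phi> x = \<phi> y"
    then have "\<phi> (x \<ominus>\<^bsub>A\<^esub> y) = \<zero>\<^bsub>B\<^esub>"
      by (simp add: module_hom_minus [OF mod(3,4) lin(1)] \<phi>_closed)
    then have "x \<ominus>\<^bsub>A\<^esub> y = \<zero>\<^bsub>A\<^esub>"
      using xy by (intro ker) auto
    then show "x = y" using xy by simp
  qed
  \<comment> \<open>Lift \<open>\<rho> y\<close> to some \<open>x\<close> in \<open>A\<close>. The
    error \<open>y - \<phi> x\<close> is killed by \<open>\<rho>\<close>, hence equals
    \<open>j w = \<phi> (i w)\<close>, and \<open>x + i w\<close> is a preimage of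
    \<open>y\<close>.\<close>
  moreover have "\<exists>a\<in>carrier A. \<phi> a = y" if y: "y \<in> carrier B" for y
  proof -
    have "\<rho> y \<in> \<pi> ` carrier A"
      using y alg_homD(2) [OF b(5)] by (simp only: a(8))
    then obtain x where x: "x \<in> carrier A" "\<pi> x = \<rho> y"
      by (auto elim: imageE)
    then have "\<rho> (y \<ominus>\<^bsub>B\<^esub> \<phi> x) = \<rho> (\<phi> x \<ominus>\<^bsub>B\<^esub> \<phi> x)"
      using y \<rho>\<phi> \<phi>_closed by (simp only: module_hom_minus [OF mod(4,1) lin(4)])
    also have "\<dots> = \<zero>\<^bsub>Q\<^esub>"
      using x \<phi>_closed module_hom_zero [OF mod(4,1) lin(4)]
      by (simp add: a_minus_def B.module.M.r_neg)
    finally have "\<rho> (y \<ominus>\<^bsub>B\<^esub> \<phi> x) = \<zero>\<^bsub>Q\<^esub>" .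
    then have "y \<ominus>\<^bsub>B\<^esub> \<phi> x \<in> j ` carrier W"
      using x y \<phi>_closed by (simp add: b(7))
    then obtain w where w: "w \<in> carrier W" "y \<ominus>\<^bsub>B\<^esub> \<phi> x = j w"
      by (auto elim: imageE)
    have "\<phi> (x \<oplus>\<^bsub>A\<^esub> i w) = \<phi> x \<oplus>\<^bsub>B\<^esub> (y \<ominus>\<^bsub>B\<^esub> \<phi> x)"
      using x w i \<phi>i alg_homD(3) [OF \<phi>] by simp
    also have "\<dots> = y"
      using x y \<phi>_closed by (simp add: a_minus_def B.module.M.a_ac B.module.M.r_neg)
    finally show ?thesis
      using x w i by (metis A.module.M.a_closed)
  qed
  then have "\<phi> ` carrier A = carrier B"
    using \<phi>_closed by force
  ultimately show ?thesis
    by (simp add: bij_betw_def)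
qed

text \<open>Identities and composites give reflexivity and transitivity. Symmetry is where the short
  five lemma enters: it makes the connecting morphism bijective, and the inverse of that morphism
  connects the extensions in the other direction.\<close>

lemma equiv_ext_rel: "equiv {E. is_extension K Q W E} (ext_rel K Q W)"
proof (rule equivI)
  show "ext_rel K Q W \<subseteq> {E. is_extension K Q W E} \<times> {E. is_extension K Q W E}"
    by (auto simp: ext_rel_def)
  have "(\<lambda>a. a) \<in> alg_hom K A A" for A
    by (simp add: alg_hom_def module_hom_def)
  then have "ext_equivalent K W E E" for E
    by (cases E) (auto simp: ext_equivalent_def intro!: bexI [of _ "\<lambda>a. a"])
  then show "refl_on {E. is_extension K Q W E} (ext_rel K Q W)"
    by (auto simp: refl_on_def ext_rel_def)
  show "trans (ext_rel K Q W)"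
  proof (rule transI)
    fix E F G assume "(E, F) \<in> ext_rel K Q W" "(F, G) \<in> ext_rel K Q W"
    moreover obtain A i \<pi> B j \<rho> C k \<sigma> where EFG: "E = (A, i, \<pi>)" "F = (B, j, \<rho>)" "G = (C, k, \<sigma>)"
      by (metis prod_cases3)
    ultimately obtain \<phi> \<psi> where *: "\<phi> \<in> alg_hom K A B" "\<psi> \<in> alg_hom K B C"
      "\<forall>w\<in>carrier W. \<phi> (i w) = j w" "\<forall>a\<in>carrier A. \<rho> (\<phi> a) = \<pi> a"
      "\<forall>w\<in>carrier W. \<psi> (j w) = k w" "\<forall>a\<in>carrier B. \<sigma> (\<psi> a) = \<rho> a"
      "is_extension K Q W E" "is_extension K Q W G"
      by (auto simp: ext_rel_def ext_equivalent_def)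
    then have "\<psi> \<circ> \<phi> \<in> alg_hom K A C"
      by (intro alg_hom_comp)
    with * show "(E, G) \<in> ext_rel K Q W"
      by (auto simp: ext_rel_def ext_equivalent_def EFG alg_homD(2) intro!: bexI [of _ "\<psi> \<circ> \<phi>"])
  qed
  show "sym (ext_rel K Q W)"
  proof (rule symI)
    fix E F assume EF: "(E, F) \<in> ext_rel K Q W"
    obtain A i \<pi> B j \<rho> where E: "E = (A, i, \<pi>)" and F: "F = (B, j, \<rho>)"
      by (metis prod_cases3)
    from EF obtain \<phi> where \<phi>: "\<phi> \<in> alg_hom K A B"
      "\<And>w. w \<in> carrier W \<Longrightarrow> \<phi> (i w) = j w" "\<And>a. a \<in> carrier A \<Longrightarrow> \<rho> (\<phi> a) = \<pi> a"
      and ex: "is_extension K Q W (A, i, \<pi>)" "is_extension K Q W (B, j, \<rho>)"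
      by (auto simp: ext_rel_def ext_equivalent_def E F)
    note a = is_extensionD [OF ex(1)] 
    have bij: "bij_betw \<phi> (carrier A) (carrier B)"
      by (rule ext_equivalent_bij [OF ex \<phi>])
    let ?g = "inv_into (carrier A) \<phi>"
    have g: "?g y \<in> carrier A" "\<phi> (?g y) = y" if "y \<in> carrier B" for y
      using that bij by (auto simp: bij_betw_def inv_into_into f_inv_into_f)
    have "?g (j w) = i w" if "w \<in> carrier W" for w
      using that bij \<phi>(2) alg_homD(2) [OF a(4)] by (metis bij_betw_inv_into_left)
    moreover have "\<pi> (?g y) = \<rho> y" if "y \<in> carrier B" for y
      using \<phi>(3) g that by metis
    moreover have "?g \<in> alg_hom K B A"
      using a(3) \<phi>(1) bij by (rule alg_hom_inv_into)
    ultimately show "(F, E) \<in> ext_rel K Q W"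
      using ex by (auto simp: ext_rel_def ext_equivalent_def E F)
  qed
qed

section \<open>Bilinear forms and the extensions they define\<close>

locale vspace = vectorspace K P for K :: "('k, 'm) ring_scheme" and P :: "('k, 'p) module"
begin

lemma BilD:
  assumes "\<theta> \<in> Bil K P"
  shows "p \<in> carrier P \<Longrightarrow> q \<in> carrier P \<Longrightarrow> \<theta> p q \<in> carrier K"
    and "p \<in> carrier P \<Longrightarrow> p' \<in> carrier P \<Longrightarrow> q \<in> carrier P \<Longrightarrow>
      \<theta> (p \<oplus>\<^bsub>P\<^esub> p') q = \<theta> p q \<oplus>\<^bsub>K\<^esub> \<theta> p' q"
    and "p \<in> carrier P \<Longrightarrow> q \<in> carrier P \<Longrightarrow> q' \<in> carrier P \<Longrightarrow>
      \<theta> p (q \<oplus>\<^bsub>P\<^esub> q') = \<theta> p q \<oplus>\<^bsub>K\<^esub> \<theta> p q'"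
    and "c \<in> carrier K \<Longrightarrow> p \<in> carrier P \<Longrightarrow> q \<in> carrier P \<Longrightarrow>
      \<theta> (c \<odot>\<^bsub>P\<^esub> p) q = c \<otimes>\<^bsub>K\<^esub> \<theta> p q"
    and "c \<in> carrier K \<Longrightarrow> p \<in> carrier P \<Longrightarrow> q \<in> carrier P \<Longrightarrow>
      \<theta> p (c \<odot>\<^bsub>P\<^esub> q) = c \<otimes>\<^bsub>K\<^esub> \<theta> p q"
  using assms by (auto simp: Bil_def module_hom_def)

lemma BilD_zero:
  assumes "\<theta> \<in> Bil K P"
  shows "q \<in> carrier P \<Longrightarrow> \<theta> \<zero>\<^bsub>P\<^esub> q = \<zero>\<^bsub>K\<^esub>"
    and "p \<in> carrier P \<Longrightarrow> \<theta> p \<zero>\<^bsub>P\<^esub> = \<zero>\<^bsub>K\<^esub>"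
  using BilD(4) [OF assms, of "\<zero>\<^bsub>K\<^esub>" "\<zero>\<^bsub>P\<^esub>" q] BilD(5) [OF assms, of "\<zero>\<^bsub>K\<^esub>" p "\<zero>\<^bsub>P\<^esub>"]
  by (simp_all add: BilD(1) [OF assms])

text \<open>Forms in \<open>Bil\<close> are extensional in both arguments, so their values on the
  carrier determine them as functions.\<close>

lemma Bil_eqI:
  assumes "\<theta> \<in> Bil K P" "\<theta>' \<in> Bil K P"
    and "\<And>p q. p \<in> carrier P \<Longrightarrow> q \<in> carrier P \<Longrightarrow> \<theta> p q = \<theta>' p q"
  shows "\<theta> = \<theta>'"
proof (rule PiE_ext)
  show "\<theta> \<in> carrier P \<rightarrow>\<^sub>E (carrier P \<rightarrow>\<^sub>E carrier K)" "\<theta>' \<in> carrier P \<rightarrow>\<^sub>E (carrier P \<rightarrow>\<^sub>E carrier K)"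
    using assms by (auto simp: Bil_def)
  then show "\<theta> p = \<theta>' p" if "p \<in> carrier P" for p
    using that assms(3) by (intro PiE_ext [of "\<theta> p" "carrier P" "\<lambda>_. carrier K" "\<theta>' p"]) auto
qed

text \<open>Associativity holds because all triple products vanish: a product has zero component in
  \<open>P\<close>, and a bilinear form is zero once one of its arguments is.\<close>

lemma form_alg_assoc_algebra:
  assumes \<theta>: "\<theta> \<in> Bil K P"
  shows "assoc_algebra K (form_alg K P \<theta>)"
proof -
  have "\<exists>q\<in>carrier P. \<exists>y\<in>carrier K. p \<oplus>\<^bsub>P\<^esub> q = \<zero>\<^bsub>P\<^esub> \<and> x \<oplus>\<^bsub>K\<^esub> y = \<zero>\<^bsub>K\<^esub>"
    if "p \<in> carrier P" "x \<in> carrier K" for p x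
    using that M.r_neg R.r_neg M.a_inv_closed R.a_inv_closed by blast
  then have "vectorspace K (form_alg K P \<theta>)"
    by (intro vs_criteria)
      (auto simp: M.a_ac R.a_ac smult_r_distr smult_l_distr smult_assoc1 R.m_assoc R.l_distr R.r_distr
        intro: field.field_axioms)
  then show ?thesis
    by (intro assoc_algebra.intro assoc_algebra_axioms.intro) (auto simp: BilD [OF \<theta>] BilD_zero [OF \<theta>])
qed

lemma form_ext_is_extension:
  assumes \<theta>: "\<theta> \<in> Bil K P"
  shows "is_extension K (abelian_alg P) (abelian_alg (field_space K)) (form_ext K P \<theta>)"
proof -
  have "assoc_algebra K (abelian_alg P)" "assoc_algebra K (abelian_alg (field_space K))"
    by (intro assoc_abelian_alg vectorspace_field_space vectorspace_axioms field.field_axioms)+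
  moreover have "(\<lambda>x. (\<zero>\<^bsub>P\<^esub>, x)) \<in> alg_hom K (abelian_alg (field_space K)) (form_alg K P \<theta>)"
    by (simp add: alg_hom_def module_hom_def BilD_zero [OF \<theta>])
  moreover have "(\<lambda>(p, x). p) \<in> alg_hom K (form_alg K P \<theta>) (abelian_alg P)"
    by (auto simp: alg_hom_def module_hom_def)
  moreover have "(\<lambda>(p, x). p) ` (carrier P \<times> carrier K) = carrier P"
    by (force simp: image_iff)
  ultimately show ?thesis
    using form_alg_assoc_algebra [OF \<theta>]
    by (auto simp: is_extension_def form_ext_def inj_on_def)
qed

end

section \<open>Extensions with one-dimensional kernel\<close>

text \<open>This stands in for the quotient map from \<open>V\<close> to \<open>V/W\<close>. With a
  complement in place of the cosets, the target keeps the operations of \<open>V\<close> and stays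
  in the type of \<open>V\<close>.\<close>

lemma (in vectorspace) exists_projection:
  assumes W: "submodule K W V"
  obtains U pr where "submodule K U V" "pr \<in> module_hom K V (V\<lparr>carrier := U\<rparr>)" "pr ` carrier V = U"
    "\<And>v. v \<in> carrier V \<Longrightarrow> pr v = \<zero>\<^bsub>V\<^esub> \<longleftrightarrow> v \<in> W"
proof -
  obtain U where U: "submodule K U V" "U \<inter> W = {\<zero>\<^bsub>V\<^esub>}"
    and dec: "\<And>v. v \<in> carrier V \<Longrightarrow> \<exists>u\<in>U. \<exists>w\<in>W. v = u \<oplus>\<^bsub>V\<^esub> w"
    using exists_complement [OF W] by metis
  interpret U: LinearCombinations.submodule K U V by fact
  interpret W: LinearCombinations.submodule K W V by fact
  have UV: "u \<in> carrier V" if "u \<in> U" for u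
    using that U.subset by auto
  have WV: "w \<in> carrier V" if "w \<in> W" for w
    using that W.subset by auto
  have minus_mem: "x \<ominus>\<^bsub>V\<^esub> y \<in> N" if "submodule K N V" "x \<in> N" "y \<in> N" for N x y
  proof -
    interpret N: LinearCombinations.submodule K N V by fact
    have "x \<ominus>\<^bsub>V\<^esub> y = x \<oplus>\<^bsub>V\<^esub> (\<ominus>\<^bsub>K\<^esub> \<one>\<^bsub>K\<^esub> \<odot>\<^bsub>V\<^esub> y)"
      using that N.subset by (simp add: smult_l_minus a_minus_def subset_iff)
    also have "\<dots> \<in> N" using that by auto
    finally show ?thesis .
  qed
  define pr where "pr v = (SOME u. u \<in> U \<and> (\<exists>w\<in>W. v = u \<oplus>\<^bsub>V\<^esub> w))" for v
  have pr_ex: "pr v \<in> U \<and> (\<exists>w\<in>W. v = pr v \<oplus>\<^bsub>V\<^esub> w)" if "v \<in> carrier V" for v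
    unfolding pr_def by (rule someI_ex) (use dec that in blast)
  \<comment> \<open>The choice made in \<open>pr\<close> is forced: from
    \<open>u + w = u' + w'\<close> the difference \<open>u - u' = w' - w\<close> lies in both
    \<open>U\<close> and \<open>W\<close>, hence is zero. Linearity then follows by adding and
    scaling decompositions.\<close>
  have pr_eq: "pr (u \<oplus>\<^bsub>V\<^esub> w) = u" if u: "u \<in> U" and w: "w \<in> W" for u w
  proof -
    have "u \<oplus>\<^bsub>V\<^esub> w \<in> carrier V" using u w UV WV by simp
    from pr_ex [OF this] obtain w' where w': "w' \<in> W" "u \<oplus>\<^bsub>V\<^esub> w = pr (u \<oplus>\<^bsub>V\<^esub> w) \<oplus>\<^bsub>V\<^esub> w'"
      and pU: "pr (u \<oplus>\<^bsub>V\<^esub> w) \<in> U" by blast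
    define u' where "u' = pr (u \<oplus>\<^bsub>V\<^esub> w)"
    have c: "u \<in> carrier V" "u' \<in> carrier V" "w \<in> carrier V" "w' \<in> carrier V"
      using u w w'(1) pU UV WV by (auto simp: u'_def)
    have eq: "u \<oplus>\<^bsub>V\<^esub> w = u' \<oplus>\<^bsub>V\<^esub> w'" using w' by (simp add: u'_def)
    have "u \<ominus>\<^bsub>V\<^esub> u' = ((u \<oplus>\<^bsub>V\<^esub> w) \<ominus>\<^bsub>V\<^esub> w) \<ominus>\<^bsub>V\<^esub> u'"
      using c by (simp add: a_minus_def M.a_ac M.r_neg)
    also have "\<dots> = (u' \<oplus>\<^bsub>V\<^esub> \<ominus>\<^bsub>V\<^esub> u') \<oplus>\<^bsub>V\<^esub> (w' \<ominus>\<^bsub>V\<^esub> w)"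
      unfolding eq using c by (simp add: a_minus_def M.a_ac)
    also have "\<dots> = w' \<ominus>\<^bsub>V\<^esub> w"
      using c by (simp add: M.r_neg)
    finally have "u \<ominus>\<^bsub>V\<^esub> u' \<in> W"
      using minus_mem [OF W w'(1) w] by simp
    moreover have "u \<ominus>\<^bsub>V\<^esub> u' \<in> U"
      using minus_mem [OF U(1) u] pU by (simp add: u'_def)
    ultimately have "u \<ominus>\<^bsub>V\<^esub> u' = \<zero>\<^bsub>V\<^esub>" using U(2) by blast
    then show ?thesis using c by (simp add: u'_def)
  qed
  have "pr \<in> module_hom K V (V\<lparr>carrier := U\<rparr>)"
  proof (rule module_homI; simp)
    fix v assume "v \<in> carrier V"
    then show "pr v \<in> U" using pr_ex by blast
  next
    fix x y assume xy: "x \<in> carrier V" "y \<in> carrier V"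
    obtain u w u' w' where d: "u \<in> U" "w \<in> W" "x = u \<oplus>\<^bsub>V\<^esub> w" "u' \<in> U" "w' \<in> W" "y = u' \<oplus>\<^bsub>V\<^esub> w'"
      using dec xy by metis
    then have "x \<oplus>\<^bsub>V\<^esub> y = (u \<oplus>\<^bsub>V\<^esub> u') \<oplus>\<^bsub>V\<^esub> (w \<oplus>\<^bsub>V\<^esub> w')"
      by (simp add: M.a_ac UV WV)
    then have "pr (x \<oplus>\<^bsub>V\<^esub> y) = u \<oplus>\<^bsub>V\<^esub> u'"
      using d pr_eq by (simp only: U.m_closed W.m_closed)
    then show "pr (x \<oplus>\<^bsub>V\<^esub> y) = pr x \<oplus>\<^bsub>V\<^esub> pr y"
      using d pr_eq by simp
  next
    fix c x assume cx: "c \<in> carrier K" "x \<in> carrier V"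
    obtain u w where d: "u \<in> U" "w \<in> W" "x = u \<oplus>\<^bsub>V\<^esub> w"
      using dec cx by metis
    then have "c \<odot>\<^bsub>V\<^esub> x = c \<odot>\<^bsub>V\<^esub> u \<oplus>\<^bsub>V\<^esub> c \<odot>\<^bsub>V\<^esub> w"
      using cx by (simp add: smult_r_distr UV WV)
    then have "pr (c \<odot>\<^bsub>V\<^esub> x) = c \<odot>\<^bsub>V\<^esub> u"
      using d cx pr_eq by (simp only: U.smult_closed W.smult_closed)
    then show "pr (c \<odot>\<^bsub>V\<^esub> x) = c \<odot>\<^bsub>V\<^esub> pr x"
      using d pr_eq by simp
  qed
  moreover have "pr ` carrier V = U"
  proof
    show "pr ` carrier V \<subseteq> U" using pr_ex by blast
    have "u = pr u" if "u \<in> U" for u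
      using pr_eq [OF that W.zero_closed] UV [OF that] by simp
    then show "U \<subseteq> pr ` carrier V" using UV by blast
  qed
  moreover have "pr v = \<zero>\<^bsub>V\<^esub> \<longleftrightarrow> v \<in> W" if v: "v \<in> carrier V" for v
  proof
    assume "pr v = \<zero>\<^bsub>V\<^esub>"
    then show "v \<in> W" using pr_ex [OF v] WV by auto
  next
    assume "v \<in> W"
    then show "pr v = \<zero>\<^bsub>V\<^esub>" using pr_eq [OF U.zero_closed, of v] v by simp
  qed
  ultimately show thesis by (rule that [OF U(1)])
qed

section \<open>Classification of the extensions of \<open>P\<^sub>0\<close> by
  \<open>k\<^sub>0\<close>\<close>

context vspace
begin

text \<open>These are the facts that the proofs below cite by number. The constants
  \<open>abelian_alg\<close> and \<open>field_space\<close> are simplified away, so that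
  \<open>i\<close> appears as a linear map on \<open>carrier K\<close> with values of zero product,
  and exactness says which elements are of the form \<open>i x\<close>.\<close>

lemma line_extensionD:
  assumes E: "is_extension K (abelian_alg P) (abelian_alg (field_space K)) (A, i, \<pi>)"
  shows "assoc_algebra K A"
    and "x \<in> carrier K \<Longrightarrow> i x \<in> carrier A"
    and "x \<in> carrier K \<Longrightarrow> y \<in> carrier K \<Longrightarrow> i (x \<oplus>\<^bsub>K\<^esub> y) = i x \<oplus>\<^bsub>A\<^esub> i y"
    and "c \<in> carrier K \<Longrightarrow> x \<in> carrier K \<Longrightarrow> i (c \<otimes>\<^bsub>K\<^esub> x) = c \<odot>\<^bsub>A\<^esub> i x"
    and "i \<zero>\<^bsub>K\<^esub> = \<zero>\<^bsub>A\<^esub>"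
    and "x \<in> carrier K \<Longrightarrow> y \<in> carrier K \<Longrightarrow> i x \<otimes>\<^bsub>A\<^esub> i y = \<zero>\<^bsub>A\<^esub>"
    and "x \<in> carrier K \<Longrightarrow> y \<in> carrier K \<Longrightarrow> i x = i y \<longleftrightarrow> x = y"
    and "\<pi> \<in> module_hom K A P" "\<pi> ` carrier A = carrier P"
    and "a \<in> carrier A \<Longrightarrow> b \<in> carrier A \<Longrightarrow> \<pi> (a \<otimes>\<^bsub>A\<^esub> b) = \<zero>\<^bsub>P\<^esub>"
    and "x \<in> carrier K \<Longrightarrow> \<pi> (i x) = \<zero>\<^bsub>P\<^esub>"
    and "a \<in> carrier A \<Longrightarrow> \<pi> a = \<zero>\<^bsub>P\<^esub> \<Longrightarrow> \<exists>x\<in>carrier K. a = i x"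
proof -
  note e = is_extensionD [OF E]
  note i = alg_homD [OF e(4)] and p = alg_homD [OF e(5)]
  show "assoc_algebra K A" by (rule e)
  then interpret A: assoc_algebra K A .
  show ix: "i x \<in> carrier A" if "x \<in> carrier K" for x
    using that i(2) by simp
  show "i (x \<oplus>\<^bsub>K\<^esub> y) = i x \<oplus>\<^bsub>A\<^esub> i y" if "x \<in> carrier K" "y \<in> carrier K" for x y
    using that i(3) by simp
  show "i (c \<otimes>\<^bsub>K\<^esub> x) = c \<odot>\<^bsub>A\<^esub> i x" if "c \<in> carrier K" "x \<in> carrier K" for c x
    using that i(4) by simp
  have "i \<zero>\<^bsub>K\<^esub> = \<zero>\<^bsub>K\<^esub> \<odot>\<^bsub>A\<^esub> i \<zero>\<^bsub>K\<^esub>"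
    using i(4) [of "\<zero>\<^bsub>K\<^esub>" "\<zero>\<^bsub>K\<^esub>"] by simp
  then show i0: "i \<zero>\<^bsub>K\<^esub> = \<zero>\<^bsub>A\<^esub>" by (simp add: ix)
  show "i x \<otimes>\<^bsub>A\<^esub> i y = \<zero>\<^bsub>A\<^esub>" if "x \<in> carrier K" "y \<in> carrier K" for x y
    using i(5) [of x y] that i0 by simp
  show "i x = i y \<longleftrightarrow> x = y" if "x \<in> carrier K" "y \<in> carrier K" for x y
    using e(6) that by (auto dest: inj_onD)
  show "\<pi> \<in> module_hom K A P" "\<pi> ` carrier A = carrier P"
    using p(1) e(8) by (simp_all add: module_hom_def)
  show "\<pi> (a \<otimes>\<^bsub>A\<^esub> b) = \<zero>\<^bsub>P\<^esub>" if "a \<in> carrier A" "b \<in> carrier A" for a b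
    using that p(5) by simp
  show "\<pi> (i x) = \<zero>\<^bsub>P\<^esub>" if "x \<in> carrier K" for x
  proof -
    have "i x \<in> i ` carrier (abelian_alg (field_space K))" using that by simp
    then show ?thesis unfolding e(7) by simp
  qed
  show "\<exists>x\<in>carrier K. a = i x" if "a \<in> carrier A" "\<pi> a = \<zero>\<^bsub>P\<^esub>" for a
  proof -
    have "a \<in> i ` carrier (abelian_alg (field_space K))" unfolding e(7) using that by simp
    then show ?thesis by (auto elim: imageE)
  qed
qed

text \<open>The kernel is the line through \<open>t\<close>, so left and right multiplication by
  \<open>a\<close> act on it by scalars, here \<open>c\<close> and \<open>d\<close>. Associativity
  makes the squares of these scalars vanish, and a field has no nonzero element of square
  zero.\<close>

lemma kernel_annihilates:
  assumes E: "is_extension K (abelian_alg P) (abelian_alg (field_space K)) (A, i, \<pi>)"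
    and a: "a \<in> carrier A" and x: "x \<in> carrier K"
  shows "a \<otimes>\<^bsub>A\<^esub> i x = \<zero>\<^bsub>A\<^esub>" and "i x \<otimes>\<^bsub>A\<^esub> a = \<zero>\<^bsub>A\<^esub>"
proof -
  note e = line_extensionD [OF E]
  interpret A: assoc_algebra K A by (rule e)
  define t where "t = i \<one>\<^bsub>K\<^esub>"
  have t: "t \<in> carrier A" by (simp add: t_def e)
  have ix: "i y = y \<odot>\<^bsub>A\<^esub> t" if "y \<in> carrier K" for y
    using e(4) [OF that R.one_closed] that by (simp add: t_def)
  obtain z where z: "z \<in> carrier K" "a \<otimes>\<^bsub>A\<^esub> a = i z"
    using e(10,12) A.alg_m_closed a by metis
  obtain c where c: "c \<in> carrier K" "a \<otimes>\<^bsub>A\<^esub> t = i c"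
    using e(10,12) A.alg_m_closed a t by metis
  \<comment> \<open>The element \<open>a (a t)\<close> is computed in two ways: as
    \<open>c\<^sup>2 t\<close>, and as \<open>(a a) t\<close>, which is a product of two kernel
    elements and hence zero.\<close>
  have "i (c \<otimes>\<^bsub>K\<^esub> c) = c \<odot>\<^bsub>A\<^esub> (a \<otimes>\<^bsub>A\<^esub> t)"
    using c e(4) by simp
  also have "\<dots> = a \<otimes>\<^bsub>A\<^esub> i c"
    using a t c by (simp add: ix A.alg_smult_r)
  also have "\<dots> = (a \<otimes>\<^bsub>A\<^esub> a) \<otimes>\<^bsub>A\<^esub> t"
    using a t c(2) by (simp add: A.alg_m_assoc)
  also have "\<dots> = i \<zero>\<^bsub>K\<^esub>"
    using z e(5,6) by (simp add: t_def)
  finally have "c \<otimes>\<^bsub>K\<^esub> c = \<zero>\<^bsub>K\<^esub>"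
    using c e(7) by simp
  then have "c = \<zero>\<^bsub>K\<^esub>"
    using c(1) integral by blast
  then have "a \<otimes>\<^bsub>A\<^esub> t = \<zero>\<^bsub>A\<^esub>"
    using c e(5) by simp
  then show "a \<otimes>\<^bsub>A\<^esub> i x = \<zero>\<^bsub>A\<^esub>"
    using a t x by (simp add: ix A.alg_smult_r)
  obtain d where d: "d \<in> carrier K" "t \<otimes>\<^bsub>A\<^esub> a = i d"
    using e(10,12) A.alg_m_closed a t by metis
  \<comment> \<open>The mirror image for right multiplication, based on
    \<open>(t a) a = t (a a)\<close>.\<close>
  have "i (d \<otimes>\<^bsub>K\<^esub> d) = d \<odot>\<^bsub>A\<^esub> (t \<otimes>\<^bsub>A\<^esub> a)"
    using d e(4) by simp
  also have "\<dots> = i d \<otimes>\<^bsub>A\<^esub> a"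
    using a t d by (simp add: ix A.alg_smult_l)
  also have "\<dots> = t \<otimes>\<^bsub>A\<^esub> (a \<otimes>\<^bsub>A\<^esub> a)"
    using a t d(2) [symmetric] by (simp add: A.alg_m_assoc)
  also have "\<dots> = i \<zero>\<^bsub>K\<^esub>"
    using z e(5,6) by (simp add: t_def)
  finally have "d \<otimes>\<^bsub>K\<^esub> d = \<zero>\<^bsub>K\<^esub>"
    using d e(7) by simp
  then have "d = \<zero>\<^bsub>K\<^esub>"
    using d(1) integral by blast
  then have "t \<otimes>\<^bsub>A\<^esub> a = \<zero>\<^bsub>A\<^esub>"
    using d e(5) by simp
  then show "i x \<otimes>\<^bsub>A\<^esub> a = \<zero>\<^bsub>A\<^esub>"
    using a t x by (simp add: ix A.alg_smult_l)
qed

text \<open>Lifts of the same element of \<open>P\<close> differ by some \<open>i x\<close>, so the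
  product of \<open>A\<close> depends only on the images of the factors in \<open>P\<close>. This
  serves both to verify that a map into \<open>A\<close> is multiplicative and to compare two forms
  belonging to the same extension.\<close>

lemma kernel_shift_mult:
  assumes E: "is_extension K (abelian_alg P) (abelian_alg (field_space K)) (A, i, \<pi>)"
    and "a \<in> carrier A" "b \<in> carrier A" "x \<in> carrier K" "y \<in> carrier K"
  shows "(a \<oplus>\<^bsub>A\<^esub> i x) \<otimes>\<^bsub>A\<^esub> (b \<oplus>\<^bsub>A\<^esub> i y) = a \<otimes>\<^bsub>A\<^esub> b"
proof -
  note e = line_extensionD [OF E]
  interpret A: assoc_algebra K A by (rule e)
  show ?thesis
    using assms(2-) e(2) kernel_annihilates [OF E]
    by (simp add: A.alg_l_distr A.alg_r_distr A.alg_m_closed)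
qed

text \<open>A linear section \<open>s\<close> splits \<open>A\<close> as a vector space into copies
  of \<open>P\<close> and \<open>k\<close>. The products \<open>s p * s q\<close> map to zero in
  \<open>P\<close>, so they lie in the kernel and define the form;
  \<open>(p, x) \<mapsto> s p + i x\<close> is then the desired equivalence.\<close>

lemma extension_form_exists:
  assumes E: "is_extension K (abelian_alg P) (abelian_alg (field_space K)) (A, i, \<pi>)"
  shows "\<exists>\<theta>\<in>Bil K P. ext_equivalent K (abelian_alg (field_space K)) (form_ext K P \<theta>) (A, i, \<pi>)"
proof -
  note e = line_extensionD [OF E]
  interpret A: assoc_algebra K A by (rule e)
  obtain s where s: "s \<in> module_hom K P A" and \<pi>s: "\<And>p. p \<in> carrier P \<Longrightarrow> \<pi> (s p) = p"
    using linear_section [OF A.vectorspace_axioms vectorspace_axioms e(8,9)] by metis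
  have s_in: "s p \<in> carrier A" if "p \<in> carrier P" for p
    using module_hom_in [OF s that] .
  have s0: "s \<zero>\<^bsub>P\<^esub> = \<zero>\<^bsub>A\<^esub>"
    by (rule module_hom_zero [OF module_axioms A.module.module_axioms s])
  \<comment> \<open>The value is the coordinate of \<open>s p * s q\<close> along \<open>i\<close>,
    determined because \<open>i\<close> is injective. Restricting both arguments gives the
    extensional form that \<open>Bil\<close> asks for.\<close>
  define \<theta> where
    "\<theta> = (\<lambda>p\<in>carrier P. \<lambda>q\<in>carrier P. SOME z. z \<in> carrier K \<and> s p \<otimes>\<^bsub>A\<^esub> s q = i z)"
  have \<theta>: "\<theta> p q \<in> carrier K" "i (\<theta> p q) = s p \<otimes>\<^bsub>A\<^esub> s q"
    if "p \<in> carrier P" "q \<in> carrier P" for p q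
  proof -
    have "\<exists>z. z \<in> carrier K \<and> s p \<otimes>\<^bsub>A\<^esub> s q = i z"
      using e(12) [OF A.alg_m_closed e(10), OF s_in s_in s_in s_in] that by (simp add: Bex_def)
    from someI_ex [OF this] that show "\<theta> p q \<in> carrier K" "i (\<theta> p q) = s p \<otimes>\<^bsub>A\<^esub> s q"
      by (simp_all add: \<theta>_def)
  qed
  have i_eq: "x = y" if "i x = i y" "x \<in> carrier K" "y \<in> carrier K" for x y
    using that e(7) by blast
  have Bil: "\<theta> \<in> Bil K P"
    unfolding Bil_def
  proof (intro CollectI conjI ballI)
    show "\<theta> \<in> carrier P \<rightarrow>\<^sub>E (carrier P \<rightarrow>\<^sub>E carrier K)"
      using \<theta>(1) by (auto simp: PiE_iff extensional_def \<theta>_def)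
  next
    fix p assume p: "p \<in> carrier P"
    \<comment> \<open>Linearity is tested after applying the injective \<open>i\<close>, where it
      becomes linearity of the product of \<open>A\<close> in its second factor.\<close>
    show "\<theta> p \<in> module_hom K P (field_space K)"
      by (intro module_homI i_eq)
        (simp_all add: \<theta> e(2-4) p s_in module_hom_add [OF s] module_hom_smult [OF s]
          A.alg_r_distr A.alg_smult_r)
  next
    fix q assume q: "q \<in> carrier P"
    show "(\<lambda>p. \<theta> p q) \<in> module_hom K P (field_space K)"
      by (intro module_homI i_eq)
        (simp_all add: \<theta> e(2-4) q s_in module_hom_add [OF s] module_hom_smult [OF s]
          A.alg_l_distr A.alg_smult_l)
  qed
  define \<phi> where "\<phi> = (\<lambda>(p, x). s p \<oplus>\<^bsub>A\<^esub> i x)"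
  have "\<phi> \<in> alg_hom K (form_alg K P \<theta>) A"
  proof (intro alg_homI module_homI)
    show "\<phi> v \<in> carrier A" if "v \<in> carrier (form_alg K P \<theta>)" for v
      using that s_in e(2) by (auto simp: \<phi>_def)
    show "\<phi> (v \<oplus>\<^bsub>form_alg K P \<theta>\<^esub> w) = \<phi> v \<oplus>\<^bsub>A\<^esub> \<phi> w"
      if "v \<in> carrier (form_alg K P \<theta>)" "w \<in> carrier (form_alg K P \<theta>)" for v w
      using that s_in e(2,3) module_hom_add [OF s] by (auto simp: \<phi>_def A.module.M.a_ac)
    show "\<phi> (c \<odot>\<^bsub>form_alg K P \<theta>\<^esub> v) = c \<odot>\<^bsub>A\<^esub> \<phi> v"
      if "c \<in> carrier K" "v \<in> carrier (form_alg K P \<theta>)" for c v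
      using that s_in e(2,4) module_hom_smult [OF s] by (auto simp: \<phi>_def A.module.smult_r_distr)
    \<comment> \<open>The product in \<open>form_alg\<close> is sent to
      \<open>s 0 + i (\<theta> p q) = s p * s q\<close>, and \<open>kernel_shift_mult\<close>
      removes the kernel summands from the product of the images.\<close>
    show "\<phi> (v \<otimes>\<^bsub>form_alg K P \<theta>\<^esub> w) = \<phi> v \<otimes>\<^bsub>A\<^esub> \<phi> w"
      if "v \<in> carrier (form_alg K P \<theta>)" "w \<in> carrier (form_alg K P \<theta>)" for v w
      using that s_in e(2) s0 \<theta> by (auto simp: \<phi>_def kernel_shift_mult [OF E] A.alg_m_closed)
  qed
  moreover have "\<phi> (\<zero>\<^bsub>P\<^esub>, x) = i x" if "x \<in> carrier K" for x
    using that e(2) s0 by (simp add: \<phi>_def)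
  moreover have "\<pi> (\<phi> (p, x)) = p" if "p \<in> carrier P" "x \<in> carrier K" for p x
    using that e(2,11) s_in \<pi>s by (simp add: \<phi>_def module_hom_add [OF e(8)])
  ultimately have "ext_equivalent K (abelian_alg (field_space K)) (form_ext K P \<theta>) (A, i, \<pi>)"
    by (auto simp: ext_equivalent_def form_ext_def)
  with Bil show ?thesis by blast
qed

text \<open>Each equivalence gives a section of \<open>\<pi>\<close>, namely the image of
  \<open>(p, 0)\<close>, and the products of its values are the images under \<open>i\<close> of the
  values of the form. Two sections differ by kernel elements, to which products are
  insensitive.\<close>

lemma extension_form_unique:
  assumes E: "is_extension K (abelian_alg P) (abelian_alg (field_space K)) (A, i, \<pi>)"
    and \<theta>: "\<theta> \<in> Bil K P" and \<theta>': "\<theta>' \<in> Bil K P"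
    and "ext_equivalent K (abelian_alg (field_space K)) (form_ext K P \<theta>) (A, i, \<pi>)"
    and "ext_equivalent K (abelian_alg (field_space K)) (form_ext K P \<theta>') (A, i, \<pi>)"
  shows "\<theta> = \<theta>'"
proof -
  note e = line_extensionD [OF E]
  interpret A: assoc_algebra K A by (rule e)
  obtain \<phi> \<psi> where \<phi>: "\<phi> \<in> alg_hom K (form_alg K P \<theta>) A"
      "\<And>x. x \<in> carrier K \<Longrightarrow> \<phi> (\<zero>\<^bsub>P\<^esub>, x) = i x"
      "\<And>p x. p \<in> carrier P \<Longrightarrow> x \<in> carrier K \<Longrightarrow> \<pi> (\<phi> (p, x)) = p"
    and \<psi>: "\<psi> \<in> alg_hom K (form_alg K P \<theta>') A"
      "\<And>x. x \<in> carrier K \<Longrightarrow> \<psi> (\<zero>\<^bsub>P\<^esub>, x) = i x"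
      "\<And>p x. p \<in> carrier P \<Longrightarrow> x \<in> carrier K \<Longrightarrow> \<pi> (\<psi> (p, x)) = p"
    using assms(4,5) by (auto simp: ext_equivalent_def form_ext_def)
  define f g where "f p = \<phi> (p, \<zero>\<^bsub>K\<^esub>)" and "g p = \<psi> (p, \<zero>\<^bsub>K\<^esub>)" for p
  have f: "f p \<in> carrier A" and g: "g p \<in> carrier A" if "p \<in> carrier P" for p
    using that alg_homD(2) [OF \<phi>(1)] alg_homD(2) [OF \<psi>(1)] by (simp_all add: f_def g_def)
  \<comment> \<open>Both \<open>f p\<close> and \<open>g p\<close> lie over \<open>p\<close>, so
    their difference lies in the kernel.\<close>
  have shift: "\<exists>x\<in>carrier K. f p = g p \<oplus>\<^bsub>A\<^esub> i x" if p: "p \<in> carrier P" for p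
  proof -
    have "\<pi> (f p \<ominus>\<^bsub>A\<^esub> g p) = p \<ominus>\<^bsub>P\<^esub> p"
      using p f g \<phi>(3) \<psi>(3)
      by (simp add: module_hom_minus [OF A.module.module_axioms module_axioms e(8)]) (simp add: f_def g_def)
    also have "\<dots> = \<zero>\<^bsub>P\<^esub>"
      using p by (simp add: a_minus_def M.r_neg)
    finally obtain x where x: "x \<in> carrier K" "f p \<ominus>\<^bsub>A\<^esub> g p = i x"
      using e(12) f [OF p] g [OF p] A.module.M.minus_closed by blast
    have "f p = g p \<oplus>\<^bsub>A\<^esub> (f p \<ominus>\<^bsub>A\<^esub> g p)"
      using f [OF p] g [OF p] by (simp add: a_minus_def A.module.M.a_ac A.module.M.r_neg)
    with x show ?thesis by auto
  qed
  show ?thesis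
  proof (rule Bil_eqI [OF \<theta> \<theta>'])
    fix p q assume pq: "p \<in> carrier P" "q \<in> carrier P"
    have "i (\<theta> p q) = f p \<otimes>\<^bsub>A\<^esub> f q"
      using pq \<phi>(2) [of "\<theta> p q"] alg_homD(5) [OF \<phi>(1), of "(p, \<zero>\<^bsub>K\<^esub>)" "(q, \<zero>\<^bsub>K\<^esub>)"]
      by (simp add: f_def BilD(1) [OF \<theta>])
    also have "\<dots> = g p \<otimes>\<^bsub>A\<^esub> g q"
      using shift [OF pq(1)] shift [OF pq(2)] g pq by (auto simp: kernel_shift_mult [OF E])
    also have "\<dots> = i (\<theta>' p q)"
      using pq \<psi>(2) [of "\<theta>' p q"] alg_homD(5) [OF \<psi>(1), of "(p, \<zero>\<^bsub>K\<^esub>)" "(q, \<zero>\<^bsub>K\<^esub>)"]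
      by (simp add: g_def BilD(1) [OF \<theta>'])
    finally show "\<theta> p q = \<theta>' p q"
      using pq e(7) BilD(1) [OF \<theta>] BilD(1) [OF \<theta>'] by blast
  qed
qed

text \<open>The type of \<open>form_ext\<close> makes this \<open>Ext\<close> range over total
  algebras in \<open>'p \<times> 'k\<close>. Total algebras in other types are reached by
  \<open>extension_form_exists\<close> and \<open>extension_form_unique\<close>, which leave the
  type of \<open>A\<close> open.\<close>

lemma bij_betw_Bil_Ext:
  "bij_betw
    (\<lambda>\<theta>. ext_rel K (abelian_alg P) (abelian_alg (field_space K)) `` {form_ext K P \<theta>})
    (Bil K P)
    (Ext K (abelian_alg P) (abelian_alg (field_space K)))"
    (is "bij_betw (\<lambda>\<theta>. ?R `` {form_ext K P \<theta>}) _ _")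
proof -
  let ?W = "abelian_alg (field_space K)"
  let ?X = "{E. is_extension K (abelian_alg P) ?W E}"
  have eq: "equiv ?X ?R" by (rule equiv_ext_rel)
  have ext: "is_extension K (abelian_alg P) ?W (form_ext K P \<theta>)" if "\<theta> \<in> Bil K P" for \<theta>
    using that by (rule form_ext_is_extension)
  have "inj_on (\<lambda>\<theta>. ?R `` {form_ext K P \<theta>}) (Bil K P)"
  proof (rule inj_onI)
    fix \<theta> \<theta>' assume *: "\<theta> \<in> Bil K P" "\<theta>' \<in> Bil K P" "?R `` {form_ext K P \<theta>} = ?R `` {form_ext K P \<theta>'}"
    then have "(form_ext K P \<theta>, form_ext K P \<theta>') \<in> ?R"
      using eq_equiv_class_iff [OF eq] ext by simp
    \<comment> \<open>Uniqueness is applied with \<open>form_ext K P \<theta>'\<close> itself as the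
      target extension: \<open>\<theta>\<close> reaches it by the equality of classes and
      \<open>\<theta>'\<close> by reflexivity.\<close>
    moreover have "(form_ext K P \<theta>', form_ext K P \<theta>') \<in> ?R"
      using equivE [OF eq] ext [OF *(2)] by (blast dest: refl_onD)
    ultimately have "ext_equivalent K ?W (form_ext K P \<theta>) (form_ext K P \<theta>')"
      "ext_equivalent K ?W (form_ext K P \<theta>') (form_ext K P \<theta>')"
      by (simp_all add: ext_rel_def)
    with * ext [OF *(2)] show "\<theta> = \<theta>'"
      unfolding form_ext_def [of K P \<theta>'] by (intro extension_form_unique)
        (simp_all add: form_ext_def)
  qed
  moreover have "?R `` {form_ext K P \<theta>} \<in> Ext K (abelian_alg P) ?W" if "\<theta> \<in> Bil K P" for \<theta>
    using ext [OF that] by (auto simp: Ext_def intro: quotientI)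
  moreover have "\<exists>\<theta>\<in>Bil K P. C = ?R `` {form_ext K P \<theta>}" if C: "C \<in> Ext K (abelian_alg P) ?W" for C
  proof -
    obtain E where E: "is_extension K (abelian_alg P) ?W E" "C = ?R `` {E}"
      using C by (auto simp: Ext_def elim: quotientE)
    obtain A i \<pi> where "E = (A, i, \<pi>)" by (metis prod_cases3)
    with E(1) obtain \<theta> where \<theta>: "\<theta> \<in> Bil K P" "ext_equivalent K ?W (form_ext K P \<theta>) E"
      using extension_form_exists by blast
    then have "(form_ext K P \<theta>, E) \<in> ?R"
      using ext E(1) by (simp add: ext_rel_def)
    then show ?thesis
      using equiv_class_eq [OF eq] \<theta>(1) E(2) by blast
  qed
  ultimately show ?thesis
    unfolding bij_betw_def by blast
qed

end

section \<open>Metabelian algebras with one-dimensional derived algebra\<close>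

text \<open>Since \<open>Q\<close> has zero multiplication, \<open>\<pi>\<close> kills all products
  and hence their span. The derived algebra thus lies in the image of \<open>W\<close>, where
  products vanish as well.\<close>

lemma metabelian_derived_mult_zero:
  fixes A :: "('k, 'a) module"
  assumes A: "assoc_algebra K A" and "metabelian K A"
    and "x \<in> derived_algebra K A" "y \<in> derived_algebra K A"
  shows "x \<otimes>\<^bsub>A\<^esub> y = \<zero>\<^bsub>A\<^esub>"
proof -
  interpret A: assoc_algebra K A by fact
  obtain Q :: "('k, 'a set) module" and W :: "('k, 'a) module" and i \<pi>
    where QW: "vectorspace K Q" "vectorspace K W"
      and E: "is_extension K (abelian_alg Q) (abelian_alg W) (A, i, \<pi>)"
    using assms(2) unfolding metabelian_def by blast
  note e = is_extensionD [OF E]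
  have mod: "module K W" using QW(2) by (simp add: vectorspace_def)
  interpret W: module K W by (rule mod)
  have "i \<in> module_hom K W A"
    using alg_homD(1) [OF e(4)] by (simp add: module_hom_def)
  then have i0: "i \<zero>\<^bsub>W\<^esub> = \<zero>\<^bsub>A\<^esub>"
    by (rule module_hom_zero [OF mod A.module.module_axioms])
  have \<pi>: "\<pi> \<in> module_hom K A Q"
    using alg_homD(1) [OF e(5)] by (simp add: module_hom_def)
  interpret p: mod_hom K A Q \<pi>
    using \<pi> A.module.module_axioms QW(1) by (simp add: mod_hom_def mod_hom_axioms_def vectorspace_def)
  have "{x \<otimes>\<^bsub>A\<^esub> y | x y. x \<in> carrier A \<and> y \<in> carrier A} \<subseteq> p.ker"
    using alg_homD(5) [OF e(5)] A.alg_m_closed by (auto simp: p.ker_def)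
  then have "derived_algebra K A \<subseteq> p.ker"
    unfolding derived_algebra_def by (rule A.module.span_is_subset [OF _ p.ker_is_submodule])
  also have "p.ker = i ` carrier (abelian_alg W)"
    unfolding e(7) by (simp add: p.ker_def)
  finally have "x \<in> i ` carrier W" "y \<in> i ` carrier W"
    using assms(3,4) by auto
  then obtain v w where "v \<in> carrier W" "x = i v" "w \<in> carrier W" "y = i w"
    by (auto elim!: imageE)
  then show ?thesis
    using alg_homD(5) [OF e(4), of v w] i0 by simp
qed

text \<open>A basis consists of one vector, and its span is the line through it. Applied to the
  derived algebra, this supplies the generator of the kernel.\<close>

lemma (in vectorspace) dim_1_line:
  assumes "fin_dim" "dim = 1"
  obtains v where "v \<in> carrier V" "v \<noteq> \<zero>\<^bsub>V\<^esub>" "carrier V = (\<lambda>c. c \<odot>\<^bsub>V\<^esub> v) ` carrier K"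
proof -
  obtain B where B: "finite B" "basis B"
    using finite_basis_exists [OF assms(1)] by blast
  then have "card B = 1"
    using dim_basis [OF B] assms(2) by simp
  then obtain v where v: "B = {v}"
    by (auto simp: card_1_singleton_iff)
  have vV: "v \<in> carrier V" and li: "lin_indpt {v}" and gen: "span {v} = carrier V"
    using B(2) unfolding v basis_def by auto
  have "v \<noteq> \<zero>\<^bsub>V\<^esub>"
    using vs_zero_lin_dep [OF _ li] vV by auto
  moreover have "span {v} \<subseteq> (\<lambda>c. c \<odot>\<^bsub>V\<^esub> v) ` carrier K"
    using vV by (intro span_is_subset line_submodule) (force intro: image_eqI [of _ _ "\<one>\<^bsub>K\<^esub>"])+
  then have "carrier V = (\<lambda>c. c \<odot>\<^bsub>V\<^esub> v) ` carrier K"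
    using gen vV by auto
  ultimately show thesis using that vV by blast
qed

text \<open>The derived algebra plays the role of \<open>k\<^sub>0\<close> and a complement of it
  that of \<open>Q\<close>, which keeps \<open>Q\<close> in the type of \<open>A\<close>. The form
  comes from \<open>extension_form_exists\<close>, and the short five lemma turns the equivalence
  into an isomorphism. That \<open>A\<close> is metabelian enters through
  \<open>metabelian_derived_mult_zero\<close>.\<close>

lemma metabelian_derived_dim_1:
  fixes A :: "('k, 'a) module"
  assumes A: "assoc_algebra K A" "metabelian K A"
    and dim: "vectorspace.fin_dim K (A\<lparr>carrier := derived_algebra K A\<rparr>)"
      "vectorspace.dim K (A\<lparr>carrier := derived_algebra K A\<rparr>) = 1"
  shows "\<exists>(Q :: ('k, 'a) module) \<theta>.
    vectorspace K Q \<and> \<theta> \<in> Bil K Q \<and> alg_isomorphic K A (form_alg K Q \<theta>)"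
proof -
  interpret A: assoc_algebra K A by fact
  let ?D = "derived_algebra K A"
  have prods: "{x \<otimes>\<^bsub>A\<^esub> y | x y. x \<in> carrier A \<and> y \<in> carrier A} \<subseteq> carrier A"
    using A.alg_m_closed by auto
  have D: "submodule K ?D A"
    unfolding derived_algebra_def using prods by (rule A.module.span_is_submodule)
  have mem_D: "x \<otimes>\<^bsub>A\<^esub> y \<in> ?D" if "x \<in> carrier A" "y \<in> carrier A" for x y
    using A.module.in_own_span [OF prods] that unfolding derived_algebra_def by blast
  have sub_vs: "vectorspace K (A\<lparr>carrier := N\<rparr>)" if "submodule K N A" for N
    using that by (intro A.subspace_is_vs) (simp add: subspace_def A.vectorspace_axioms)
  interpret D: vectorspace K "A\<lparr>carrier := ?D\<rparr>"
    by (rule sub_vs [OF D])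
  obtain t where t: "t \<in> ?D" "t \<noteq> \<zero>\<^bsub>A\<^esub>" "?D = (\<lambda>c. c \<odot>\<^bsub>A\<^esub> t) ` carrier K"
    using D.dim_1_line [OF dim] by auto
  have tA: "t \<in> carrier A"
    using t(1) D by (auto simp: submodule_def)
  obtain U pr where U: "submodule K U A" and pr: "pr \<in> module_hom K A (A\<lparr>carrier := U\<rparr>)"
      "pr ` carrier A = U" "\<And>v. v \<in> carrier A \<Longrightarrow> pr v = \<zero>\<^bsub>A\<^esub> \<longleftrightarrow> v \<in> ?D"
    using A.exists_projection [OF D] by blast
  define Q where "Q = A\<lparr>carrier := U\<rparr>"
  have "vectorspace K Q"
    unfolding Q_def by (rule sub_vs [OF U])
  then interpret Q: vspace K Q by (simp add: vspace_def)
  let ?i = "\<lambda>c. c \<odot>\<^bsub>A\<^esub> t"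
  \<comment> \<open>The map \<open>c \<mapsto> c t\<close> respects products because
    \<open>k\<^sub>0\<close> has zero multiplication and products of elements of the derived algebra
    vanish.\<close>
  have "?i \<in> alg_hom K (abelian_alg (field_space K)) A"
    using tA t(1) metabelian_derived_mult_zero [OF A] t(3)
    by (intro alg_homI module_homI) (auto simp: A.module.smult_l_distr A.module.smult_assoc1)
  moreover have "pr \<in> alg_hom K A (abelian_alg Q)"
  proof (rule alg_homI)
    show "pr \<in> module_hom K A (abelian_alg Q)"
      using pr(1) by (simp add: module_hom_def Q_def)
    show "pr (x \<otimes>\<^bsub>A\<^esub> y) = pr x \<otimes>\<^bsub>abelian_alg Q\<^esub> pr y" if "x \<in> carrier A" "y \<in> carrier A" for x y
      using pr(3) [OF A.alg_m_closed [OF that]] mem_D [OF that] by (simp add: Q_def)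
  qed
  moreover have "inj_on ?i (carrier K)"
  proof (rule inj_onI)
    fix x y assume xy: "x \<in> carrier K" "y \<in> carrier K" "x \<odot>\<^bsub>A\<^esub> t = y \<odot>\<^bsub>A\<^esub> t"
    then have "(x \<ominus>\<^bsub>K\<^esub> y) \<odot>\<^bsub>A\<^esub> t = \<zero>\<^bsub>A\<^esub>"
      using tA by (simp add: a_minus_def A.module.smult_l_distr A.module.smult_l_minus A.module.M.r_neg)
    \<comment> \<open>A nonzero scalar could be inverted here, which would give
      \<open>t = 0\<close>.\<close>
    then have "x \<ominus>\<^bsub>K\<^esub> y = \<zero>\<^bsub>K\<^esub>"
      using A.module.R.minus_closed xy t(2) tA
      by (metis A.smult_assoc1 A.smult_one A.smult_r_null A.field_Units A.Units_l_inv
        Diff_iff singletonD A.Units_inv_closed)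
    then show "x = y" using xy by simp
  qed
  moreover have "?i ` carrier K = {a \<in> carrier A. pr a = \<zero>\<^bsub>Q\<^esub>}"
    using pr(3) t(3) D by (auto simp: Q_def submodule_def)
  moreover have "pr ` carrier A = carrier Q"
    using pr(2) by (simp add: Q_def)
  ultimately have E: "is_extension K (abelian_alg Q) (abelian_alg (field_space K)) (A, ?i, pr)"
    using A(1) assoc_abelian_alg [OF Q.vectorspace_axioms]
      assoc_abelian_alg [OF vectorspace_field_space [OF A.field.field_axioms]]
    by (simp add: is_extension_def)
  from Q.extension_form_exists [OF E] obtain \<theta> where \<theta>: "\<theta> \<in> Bil K Q"
    "ext_equivalent K (abelian_alg (field_space K)) (form_ext K Q \<theta>) (A, ?i, pr)" by blast
  from \<theta>(2) obtain \<phi> where \<phi>: "\<phi> \<in> alg_hom K (form_alg K Q \<theta>) A"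
    "\<And>w. w \<in> carrier (abelian_alg (field_space K)) \<Longrightarrow> \<phi> ((\<lambda>x. (\<zero>\<^bsub>Q\<^esub>, x)) w) = ?i w"
    "\<And>a. a \<in> carrier (form_alg K Q \<theta>) \<Longrightarrow> pr (\<phi> a) = (\<lambda>(p, x). p) a"
    unfolding ext_equivalent_def form_ext_def by blast
  have "bij_betw \<phi> (carrier (form_alg K Q \<theta>)) (carrier A)"
    by (rule ext_equivalent_bij [OF Q.form_ext_is_extension [OF \<theta>(1), unfolded form_ext_def] E \<phi>])
  then have "alg_isomorphic K A (form_alg K Q \<theta>)"
    using \<phi>(1) by (intro alg_isomorphic_sym [OF Q.form_alg_assoc_algebra [OF \<theta>(1)]])
      (auto simp: alg_isomorphic_def)
  with \<theta>(1) \<open>vectorspace K Q\<close> show ?thesis by blast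
qed

section \<open>Isomorphisms of the algebras of bilinear forms\<close>

lemma lin_autD:
  assumes "\<psi> \<in> lin_aut K P"
  shows "\<psi> \<in> module_hom K P P" "bij_betw \<psi> (carrier P) (carrier P)" "\<psi> \<in> extensional (carrier P)"
    "p \<in> carrier P \<Longrightarrow> \<psi> p \<in> carrier P"
  using assms by (auto simp: lin_aut_def Bij_def module_hom_in)

lemma dual_spaceD:
  assumes "l \<in> dual_space K P"
  shows "l \<in> module_hom K P (field_space K)" "l \<in> extensional (carrier P)"
    "p \<in> carrier P \<Longrightarrow> l p \<in> carrier K"
    "p \<in> carrier P \<Longrightarrow> q \<in> carrier P \<Longrightarrow> l (p \<oplus>\<^bsub>P\<^esub> q) = l p \<oplus>\<^bsub>K\<^esub> l q"
    "c \<in> carrier K \<Longrightarrow> p \<in> carrier P \<Longrightarrow> l (c \<odot>\<^bsub>P\<^esub> p) = c \<otimes>\<^bsub>K\<^esub> l p"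
  using assms by (auto simp: dual_space_def module_hom_def)

lemma form_alg_proj:
  "fst (v \<oplus>\<^bsub>form_alg K P \<theta>\<^esub> w) = fst v \<oplus>\<^bsub>P\<^esub> fst w"
  "snd (v \<oplus>\<^bsub>form_alg K P \<theta>\<^esub> w) = snd v \<oplus>\<^bsub>K\<^esub> snd w"
  "fst (c \<odot>\<^bsub>form_alg K P \<theta>\<^esub> v) = c \<odot>\<^bsub>P\<^esub> fst v"
  "snd (c \<odot>\<^bsub>form_alg K P \<theta>\<^esub> v) = c \<otimes>\<^bsub>K\<^esub> snd v"
  "fst (v \<otimes>\<^bsub>form_alg K P \<theta>\<^esub> w) = \<zero>\<^bsub>P\<^esub>"
  "snd (v \<otimes>\<^bsub>form_alg K P \<theta>\<^esub> w) = \<theta> (fst v) (fst w)"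
  by (cases v; cases w; simp)+

section \<open>Triangular maps on \<open>P \<times> k\<close>\<close>

context vspace
begin

text \<open>Elements of \<open>Bij\<close> are extensional, hence the restriction to the carrier.
  The argument is a single triple so that the map can be used directly as a homomorphism on
  \<open>form_group\<close>.\<close>

definition triangular :: "'k \<times> ('p \<Rightarrow> 'k) \<times> ('p \<Rightarrow> 'p) \<Rightarrow> 'p \<times> 'k \<Rightarrow> 'p \<times> 'k" where
  "triangular = (\<lambda>(u, l, \<psi>). \<lambda>(p, x)\<in>carrier P \<times> carrier K. (\<psi> p, l p \<oplus>\<^bsub>K\<^esub> u \<otimes>\<^bsub>K\<^esub> x))"

lemma triangular_apply:
  "p \<in> carrier P \<Longrightarrow> x \<in> carrier K \<Longrightarrow> triangular (u, l, \<psi>) (p, x) = (\<psi> p, l p \<oplus>\<^bsub>K\<^esub> u \<otimes>\<^bsub>K\<^esub> x)"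
  by (simp add: triangular_def)

lemma dual_space_zero:
  assumes "l \<in> dual_space K P"
  shows "l \<zero>\<^bsub>P\<^esub> = \<zero>\<^bsub>K\<^esub>"
  using dual_spaceD(5) [OF assms, of "\<zero>\<^bsub>K\<^esub>" "\<zero>\<^bsub>P\<^esub>"] dual_spaceD(3) [OF assms] by simp

lemma add_minus_cancel:
  assumes "x \<in> carrier K" "y \<in> carrier K"
  shows "x \<oplus>\<^bsub>K\<^esub> (y \<ominus>\<^bsub>K\<^esub> x) = y"
proof -
  have "y \<ominus>\<^bsub>K\<^esub> x = \<ominus>\<^bsub>K\<^esub> x \<oplus>\<^bsub>K\<^esub> y"
    using assms by (simp add: a_minus_def R.a_comm)
  then show ?thesis using assms by (simp add: R.r_neg2)
qed

lemma lin_aut_zero: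
  assumes "\<psi> \<in> lin_aut K P"
  shows "\<psi> \<zero>\<^bsub>P\<^esub> = \<zero>\<^bsub>P\<^esub>"
  by (rule module_hom_zero [OF module_axioms module_axioms lin_autD(1) [OF assms]])

text \<open>The map sends a product \<open>(0, \<theta> p q)\<close> to
  \<open>(0, u \<theta> p q)\<close>, while the product of the images is
  \<open>(0, \<theta>' (\<psi> p) (\<psi> q))\<close>. Multiplicativity is therefore the assumption
  \<open>eq\<close>, whatever the functional \<open>l\<close> is.\<close>

lemma triangular_alg_hom:
  assumes \<theta>: "\<theta> \<in> Bil K P" and u: "u \<in> carrier K" and l: "l \<in> dual_space K P" and \<psi>: "\<psi> \<in> lin_aut K P"
    and eq: "\<And>p q. p \<in> carrier P \<Longrightarrow> q \<in> carrier P \<Longrightarrow> u \<otimes>\<^bsub>K\<^esub> \<theta> p q = \<theta>' (\<psi> p) (\<psi> q)"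
  shows "triangular (u, l, \<psi>) \<in> alg_hom K (form_alg K P \<theta>) (form_alg K P \<theta>')"
proof -
  note b = BilD(1) [OF \<theta>] and d = dual_spaceD(3-5) [OF l] dual_space_zero [OF l]
    and h = lin_autD(4) [OF \<psi>] module_hom_add [OF lin_autD(1) [OF \<psi>]]
      module_hom_smult [OF lin_autD(1) [OF \<psi>]] lin_aut_zero [OF \<psi>]
  show ?thesis
  proof (intro alg_homI module_homI; simp only: form_alg_simps mem_Times_iff split_paired_all fst_conv snd_conv; elim conjE)
    fix p x assume "p \<in> carrier P" "x \<in> carrier K"
    then show "fst (triangular (u, l, \<psi>) (p, x)) \<in> carrier P \<and> snd (triangular (u, l, \<psi>) (p, x)) \<in> carrier K"
      using u d(1) h(1) by (simp add: triangular_apply)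
  next
    fix p x q y assume "p \<in> carrier P" "x \<in> carrier K" "q \<in> carrier P" "y \<in> carrier K"
    then show "triangular (u, l, \<psi>) (p \<oplus>\<^bsub>P\<^esub> q, x \<oplus>\<^bsub>K\<^esub> y) =
        triangular (u, l, \<psi>) (p, x) \<oplus>\<^bsub>form_alg K P \<theta>'\<^esub> triangular (u, l, \<psi>) (q, y)"
      using u d(1,2) h(1,2) by (simp add: triangular_apply R.r_distr R.a_ac)
  next
    fix c p x assume "c \<in> carrier K" "p \<in> carrier P" "x \<in> carrier K"
    then show "triangular (u, l, \<psi>) (c \<odot>\<^bsub>P\<^esub> p, c \<otimes>\<^bsub>K\<^esub> x) =
        c \<odot>\<^bsub>form_alg K P \<theta>'\<^esub> triangular (u, l, \<psi>) (p, x)"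
      using u d(1,3) h(1,3) by (simp add: triangular_apply R.r_distr R.m_ac)
  next
    fix p x q y assume "p \<in> carrier P" "x \<in> carrier K" "q \<in> carrier P" "y \<in> carrier K"
    then show "triangular (u, l, \<psi>) (\<zero>\<^bsub>P\<^esub>, \<theta> p q) =
        triangular (u, l, \<psi>) (p, x) \<otimes>\<^bsub>form_alg K P \<theta>'\<^esub> triangular (u, l, \<psi>) (q, y)"
      using u b d(4) h(4) eq [symmetric] by (simp add: triangular_apply)
  qed
qed

lemma triangular_Bij:
  assumes u: "u \<in> carrier K" "u \<noteq> \<zero>\<^bsub>K\<^esub>" and l: "l \<in> dual_space K P" and \<psi>: "\<psi> \<in> lin_aut K P"
  shows "triangular (u, l, \<psi>) \<in> Bij (carrier P \<times> carrier K)"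
proof -
  let ?T = "triangular (u, l, \<psi>)"
  note d = dual_spaceD(3) [OF l] and h = lin_autD(4) [OF \<psi>]
  have iu: "inv\<^bsub>K\<^esub> u \<in> carrier K" "u \<otimes>\<^bsub>K\<^esub> inv\<^bsub>K\<^esub> u = \<one>\<^bsub>K\<^esub>"
    using u by (auto simp: field_Units)
  have "inj_on ?T (carrier P \<times> carrier K)"
  proof (rule inj_onI, clarify)
    fix p x q y assume c: "p \<in> carrier P" "x \<in> carrier K" "q \<in> carrier P" "y \<in> carrier K"
      and eq: "?T (p, x) = ?T (q, y)"
    then have "\<psi> p = \<psi> q" by (simp add: triangular_apply)
    then have pq: "p = q"
      using lin_autD(2) [OF \<psi>] c by (auto simp: bij_betw_def dest: inj_onD)
    then have "u \<otimes>\<^bsub>K\<^esub> x = u \<otimes>\<^bsub>K\<^esub> y"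
      using eq c u d by (simp add: triangular_apply)
    then show "p = q \<and> x = y"
      using pq u c m_lcancel by simp
  qed
  moreover have "\<exists>v\<in>carrier P \<times> carrier K. ?T v = (q, y)" if q: "q \<in> carrier P" and y: "y \<in> carrier K" for q y
  proof -
    have "q \<in> \<psi> ` carrier P"
      using lin_autD(2) [OF \<psi>] q by (simp add: bij_betw_def)
    then obtain p where p: "p \<in> carrier P" "q = \<psi> p" by blast
    \<comment> \<open>This solves \<open>l p + u x = y\<close> for \<open>x\<close>.\<close>
    let ?x = "inv\<^bsub>K\<^esub> u \<otimes>\<^bsub>K\<^esub> (y \<ominus>\<^bsub>K\<^esub> l p)"
    have "u \<otimes>\<^bsub>K\<^esub> ?x = y \<ominus>\<^bsub>K\<^esub> l p"
      using u iu y p d by (simp add: R.m_assoc [symmetric])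
    then have "?T (p, ?x) = (q, y)"
      using u iu y p d by (simp add: triangular_apply add_minus_cancel)
    moreover have "(p, ?x) \<in> carrier P \<times> carrier K"
      using iu y p d by simp
    ultimately show ?thesis by blast
  qed
  then have "?T ` (carrier P \<times> carrier K) = carrier P \<times> carrier K"
    using u d h by (fastforce simp: triangular_apply image_iff)
  ultimately show ?thesis
    by (simp add: Bij_def bij_betw_def triangular_def)
qed

text \<open>A linear bijection is triangular once the \<open>P\<close>-component of
  \<open>f (0, 1)\<close> vanishes, which is \<open>f01\<close>. Despite its name,
  \<open>nondeg\<close> only says that \<open>\<theta>\<close> is nonzero or \<open>P\<close> is
  zero. For the zero form on a nonzero \<open>P\<close>, a linear bijection may move
  \<open>(0, 1)\<close> out of \<open>0 \<times> k\<close> and still be multiplicative if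
  \<open>\<theta>'\<close> is zero too.\<close>

lemma form_alg_iso_triangular:
  assumes \<theta>: "\<theta> \<in> Bil K P" and \<theta>': "\<theta>' \<in> Bil K P"
    and f: "f \<in> alg_hom K (form_alg K P \<theta>) (form_alg K P \<theta>')"
    and bij: "bij_betw f (carrier P \<times> carrier K) (carrier P \<times> carrier K)"
    and nondeg: "(\<exists>p\<in>carrier P. \<exists>q\<in>carrier P. \<theta> p q \<noteq> \<zero>\<^bsub>K\<^esub>) \<or> carrier P = {\<zero>\<^bsub>P\<^esub>}"
  obtains u l \<psi> where "u \<in> carrier K - {\<zero>\<^bsub>K\<^esub>}" "l \<in> dual_space K P" "\<psi> \<in> lin_aut K P"
    "\<And>p q. p \<in> carrier P \<Longrightarrow> q \<in> carrier P \<Longrightarrow> u \<otimes>\<^bsub>K\<^esub> \<theta> p q = \<theta>' (\<psi> p) (\<psi> q)"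
    "\<And>v. v \<in> carrier P \<times> carrier K \<Longrightarrow> f v = triangular (u, l, \<psi>) v"
proof -
  have f_in: "fst (f (p, x)) \<in> carrier P" "snd (f (p, x)) \<in> carrier K"
    if "p \<in> carrier P" "x \<in> carrier K" for p x
    using alg_homD(2) [OF f, of "(p, x)"] that by (auto simp: mem_Times_iff)
  have f_add: "f (p \<oplus>\<^bsub>P\<^esub> q, x \<oplus>\<^bsub>K\<^esub> y) = f (p, x) \<oplus>\<^bsub>form_alg K P \<theta>'\<^esub> f (q, y)"
    if "p \<in> carrier P" "x \<in> carrier K" "q \<in> carrier P" "y \<in> carrier K" for p x q y
    using alg_homD(3) [OF f, of "(p, x)" "(q, y)"] that by simp
  have f_smult: "f (c \<odot>\<^bsub>P\<^esub> p, c \<otimes>\<^bsub>K\<^esub> x) = c \<odot>\<^bsub>form_alg K P \<theta>'\<^esub> f (p, x)"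
    if "c \<in> carrier K" "p \<in> carrier P" "x \<in> carrier K" for c p x
    using alg_homD(4) [OF f, of c "(p, x)"] that by simp
  have f_mult: "f (\<zero>\<^bsub>P\<^esub>, \<theta> p q) = f (p, x) \<otimes>\<^bsub>form_alg K P \<theta>'\<^esub> f (q, y)"
    if "p \<in> carrier P" "x \<in> carrier K" "q \<in> carrier P" "y \<in> carrier K" for p x q y
    using alg_homD(5) [OF f, of "(p, x)" "(q, y)"] that by simp
  have f_inj: "v = w" if "f v = f w" "v \<in> carrier P \<times> carrier K" "w \<in> carrier P \<times> carrier K" for v w
    using bij that by (auto simp: bij_betw_def dest: inj_onD)
  have f01: "fst (f (\<zero>\<^bsub>P\<^esub>, \<one>\<^bsub>K\<^esub>)) = \<zero>\<^bsub>P\<^esub>"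
    using nondeg
  proof
    assume "\<exists>p\<in>carrier P. \<exists>q\<in>carrier P. \<theta> p q \<noteq> \<zero>\<^bsub>K\<^esub>"
    then obtain p q where pq: "p \<in> carrier P" "q \<in> carrier P" "\<theta> p q \<noteq> \<zero>\<^bsub>K\<^esub>" by blast
    then have t: "\<theta> p q \<in> carrier K" using BilD(1) [OF \<theta>] by simp
    then have it: "inv\<^bsub>K\<^esub> \<theta> p q \<in> carrier K" "inv\<^bsub>K\<^esub> \<theta> p q \<otimes>\<^bsub>K\<^esub> \<theta> p q = \<one>\<^bsub>K\<^esub>"
      using pq(3) by (auto simp: field_Units)
    \<comment> \<open>For nonzero \<open>\<theta>\<close>, the vector \<open>(0, 1)\<close> is a
      multiple of a product \<open>(0, \<theta> p q)\<close>, and every product in the target has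
      zero \<open>P\<close>-component.\<close>
    have "fst (f (\<zero>\<^bsub>P\<^esub>, \<theta> p q)) = \<zero>\<^bsub>P\<^esub>"
      using f_mult [of p "\<zero>\<^bsub>K\<^esub>" q "\<zero>\<^bsub>K\<^esub>"] pq by (simp add: form_alg_proj)
    then show ?thesis
      using f_smult [OF it(1) M.zero_closed t] it by (simp add: form_alg_proj)
  qed (use f_in [OF M.zero_closed R.one_closed] in auto)
  \<comment> \<open>The entries are read off from the images of \<open>(0, 1)\<close> and of the
    vectors \<open>(p, 0)\<close>; by \<open>f01\<close> these are all the nonzero blocks of
    \<open>f\<close>.\<close>
  define u where "u = snd (f (\<zero>\<^bsub>P\<^esub>, \<one>\<^bsub>K\<^esub>))"
  define l where "l = (\<lambda>p\<in>carrier P. snd (f (p, \<zero>\<^bsub>K\<^esub>)))"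
  define \<psi> where "\<psi> = (\<lambda>p\<in>carrier P. fst (f (p, \<zero>\<^bsub>K\<^esub>)))"
  have uK: "u \<in> carrier K" by (simp add: u_def f_in)
  have l: "l \<in> dual_space K P"
    unfolding dual_space_def
  proof (intro IntI module_homI)
    show "l p \<in> carrier (field_space K)" if "p \<in> carrier P" for p
      using that by (simp add: l_def f_in)
    show "l (p \<oplus>\<^bsub>P\<^esub> q) = l p \<oplus>\<^bsub>field_space K\<^esub> l q" if "p \<in> carrier P" "q \<in> carrier P" for p q
      using that f_add [of p "\<zero>\<^bsub>K\<^esub>" q "\<zero>\<^bsub>K\<^esub>"] by (simp add: l_def form_alg_proj)
    show "l (c \<odot>\<^bsub>P\<^esub> p) = c \<odot>\<^bsub>field_space K\<^esub> l p" if "c \<in> carrier K" "p \<in> carrier P" for c p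
      using that f_smult [of c p "\<zero>\<^bsub>K\<^esub>"] by (simp add: l_def form_alg_proj)
  qed (simp add: l_def)
  have \<psi>_hom: "\<psi> \<in> module_hom K P P"
  proof (rule module_homI)
    show "\<psi> p \<in> carrier P" if "p \<in> carrier P" for p
      using that by (simp add: \<psi>_def f_in)
    show "\<psi> (p \<oplus>\<^bsub>P\<^esub> q) = \<psi> p \<oplus>\<^bsub>P\<^esub> \<psi> q" if "p \<in> carrier P" "q \<in> carrier P" for p q
      using that f_add [of p "\<zero>\<^bsub>K\<^esub>" q "\<zero>\<^bsub>K\<^esub>"] by (simp add: \<psi>_def form_alg_proj)
    show "\<psi> (c \<odot>\<^bsub>P\<^esub> p) = c \<odot>\<^bsub>P\<^esub> \<psi> p" if "c \<in> carrier K" "p \<in> carrier P" for c p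
      using that f_smult [of c p "\<zero>\<^bsub>K\<^esub>"] by (simp add: \<psi>_def form_alg_proj)
  qed
  note \<psi>_in = module_hom_in [OF \<psi>_hom] and l_in = dual_spaceD(3) [OF l]
  \<comment> \<open>Decompose \<open>(p, x)\<close> as \<open>(p, 0) + x (0, 1)\<close> and use
    linearity.\<close>
  have f_eq: "f (p, x) = (\<psi> p, l p \<oplus>\<^bsub>K\<^esub> u \<otimes>\<^bsub>K\<^esub> x)" if p: "p \<in> carrier P" and x: "x \<in> carrier K" for p x
  proof (rule prod_eqI)
    have f0x: "f (\<zero>\<^bsub>P\<^esub>, x) = x \<odot>\<^bsub>form_alg K P \<theta>'\<^esub> f (\<zero>\<^bsub>P\<^esub>, \<one>\<^bsub>K\<^esub>)"
      using f_smult [OF x, of "\<zero>\<^bsub>P\<^esub>" "\<one>\<^bsub>K\<^esub>"] x by simp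
    have fpx: "f (p, x) = f (p, \<zero>\<^bsub>K\<^esub>) \<oplus>\<^bsub>form_alg K P \<theta>'\<^esub> f (\<zero>\<^bsub>P\<^esub>, x)"
      using f_add [of p "\<zero>\<^bsub>K\<^esub>" "\<zero>\<^bsub>P\<^esub>" x] p x by simp
    show "fst (f (p, x)) = fst (\<psi> p, l p \<oplus>\<^bsub>K\<^esub> u \<otimes>\<^bsub>K\<^esub> x)"
      unfolding fpx f0x using p x f01 by (simp add: form_alg_proj \<psi>_def f_in)
    show "snd (f (p, x)) = snd (\<psi> p, l p \<oplus>\<^bsub>K\<^esub> u \<otimes>\<^bsub>K\<^esub> x)"
      unfolding fpx f0x using p x uK by (simp add: form_alg_proj l_def u_def R.m_comm)
  qed
  have u0: "u \<noteq> \<zero>\<^bsub>K\<^esub>"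
  proof
    assume "u = \<zero>\<^bsub>K\<^esub>"
    then have "f (\<zero>\<^bsub>P\<^esub>, \<one>\<^bsub>K\<^esub>) = f (\<zero>\<^bsub>P\<^esub>, \<zero>\<^bsub>K\<^esub>)"
      by (simp add: f_eq)
    from f_inj [OF this] show False by simp
  qed
  then have iu: "inv\<^bsub>K\<^esub> u \<in> carrier K" "u \<otimes>\<^bsub>K\<^esub> inv\<^bsub>K\<^esub> u = \<one>\<^bsub>K\<^esub>"
    using uK by (auto simp: field_Units)
  have "inj_on \<psi> (carrier P)"
  proof (rule inj_onI)
    fix p q assume pq: "p \<in> carrier P" "q \<in> carrier P" "\<psi> p = \<psi> q"
    \<comment> \<open>Chosen so that \<open>l p + u x = l q\<close>. When
      \<open>\<psi> p = \<psi> q\<close>, this makes \<open>(p, x)\<close> and \<open>(q, 0)\<close>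
      have the same image under \<open>f\<close>.\<close>
    let ?x = "inv\<^bsub>K\<^esub> u \<otimes>\<^bsub>K\<^esub> (l q \<ominus>\<^bsub>K\<^esub> l p)"
    have "u \<otimes>\<^bsub>K\<^esub> ?x = l q \<ominus>\<^bsub>K\<^esub> l p"
      using uK iu pq l_in by (simp add: R.m_assoc [symmetric])
    then have "f (p, ?x) = f (q, \<zero>\<^bsub>K\<^esub>)"
      using uK iu pq l_in by (simp add: f_eq add_minus_cancel)
    then show "p = q"
      using f_inj [of "(p, ?x)" "(q, \<zero>\<^bsub>K\<^esub>)"] iu pq l_in by simp
  qed
  moreover have "\<psi> ` carrier P = carrier P"
  proof
    show "\<psi> ` carrier P \<subseteq> carrier P" using \<psi>_in by blast
    show "carrier P \<subseteq> \<psi> ` carrier P"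
    proof
      fix q assume "q \<in> carrier P"
      then have "(q, \<zero>\<^bsub>K\<^esub>) \<in> f ` (carrier P \<times> carrier K)"
        using bij by (simp add: bij_betw_def)
      then obtain p x where "p \<in> carrier P" "x \<in> carrier K" "(q, \<zero>\<^bsub>K\<^esub>) = f (p, x)"
        by (auto elim!: imageE)
      then show "q \<in> \<psi> ` carrier P" by (auto simp: f_eq)
    qed
  qed
  ultimately have \<psi>: "\<psi> \<in> lin_aut K P"
    using \<psi>_hom by (simp add: lin_aut_def Bij_def bij_betw_def \<psi>_def)
  show thesis
  proof (rule that [OF _ l \<psi>])
    show "u \<in> carrier K - {\<zero>\<^bsub>K\<^esub>}" using uK u0 by simp
    show "u \<otimes>\<^bsub>K\<^esub> \<theta> p q = \<theta>' (\<psi> p) (\<psi> q)" if pq: "p \<in> carrier P" "q \<in> carrier P" for p q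
    proof -
      have "snd (f (\<zero>\<^bsub>P\<^esub>, \<theta> p q)) = \<theta>' (\<psi> p) (\<psi> q)"
        using f_mult [of p "\<zero>\<^bsub>K\<^esub>" q "\<zero>\<^bsub>K\<^esub>"] pq by (simp add: form_alg_proj \<psi>_def)
      then show ?thesis
        using pq BilD(1) [OF \<theta>] uK by (simp add: f_eq dual_space_zero [OF l])
    qed
    show "f v = triangular (u, l, \<psi>) v" if "v \<in> carrier P \<times> carrier K" for v
      using that by (auto simp: f_eq triangular_apply)
  qed
qed

section \<open>Isomorphism, homothety and isometry\<close>

lemma lin_aut_id: "(\<lambda>p\<in>carrier P. p) \<in> lin_aut K P"
  by (simp add: lin_aut_def id_Bij module_hom_def)

lemma zero_dual_space: "(\<lambda>p\<in>carrier P. \<zero>\<^bsub>K\<^esub>) \<in> dual_space K P"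
  by (simp add: dual_space_def module_hom_def)

text \<open>For nonzero \<open>\<theta>\<close> an isomorphism is triangular and its entries
  \<open>u\<close> and \<open>\<psi>\<close> give the homothety. The zero form needs a separate
  argument. Conversely, a homothety yields the triangular map with \<open>l = 0\<close>.\<close>

lemma alg_isomorphic_iff_homothetic:
  assumes \<theta>: "\<theta> \<in> Bil K P" and \<theta>': "\<theta>' \<in> Bil K P"
  shows "alg_isomorphic K (form_alg K P \<theta>) (form_alg K P \<theta>') \<longleftrightarrow> homothetic K P \<theta> \<theta>'"
proof
  assume "alg_isomorphic K (form_alg K P \<theta>) (form_alg K P \<theta>')"
  then obtain f where f: "f \<in> alg_hom K (form_alg K P \<theta>) (form_alg K P \<theta>')"
    "bij_betw f (carrier P \<times> carrier K) (carrier P \<times> carrier K)"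
    by (auto simp: alg_isomorphic_def)
  show "homothetic K P \<theta> \<theta>'"
  proof (cases "\<exists>p\<in>carrier P. \<exists>q\<in>carrier P. \<theta> p q \<noteq> \<zero>\<^bsub>K\<^esub>")
    case True
    then show ?thesis
      using form_alg_iso_triangular [OF \<theta> \<theta>' f] unfolding homothetic_def by metis
  next
    case False
    \<comment> \<open>If \<open>\<theta>\<close> vanishes, so do all products in the source, and
      surjectivity of \<open>f\<close> carries this over to the target. With both forms zero, the
      identity and \<open>u = 1\<close> form a homothety, even if \<open>f\<close> is not
      triangular.\<close>
    have "\<theta>' p q = \<zero>\<^bsub>K\<^esub>" if pq: "p \<in> carrier P" "q \<in> carrier P" for p q
    proof -
      have "(p, \<zero>\<^bsub>K\<^esub>) \<in> f ` (carrier P \<times> carrier K)" "(q, \<zero>\<^bsub>K\<^esub>) \<in> f ` (carrier P \<times> carrier K)"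
        using f(2) pq by (simp_all add: bij_betw_def)
      then obtain v w where v: "v \<in> carrier P \<times> carrier K" "(p, \<zero>\<^bsub>K\<^esub>) = f v"
        and w: "w \<in> carrier P \<times> carrier K" "(q, \<zero>\<^bsub>K\<^esub>) = f w"
        by (elim imageE)
      have vw: "v \<otimes>\<^bsub>form_alg K P \<theta>\<^esub> w = (\<zero>\<^bsub>P\<^esub>, \<zero>\<^bsub>K\<^esub>)"
        using v(1) w(1) False by (auto simp: mem_Times_iff form_alg_proj intro!: prod_eqI)
      have "\<theta>' p q = snd (f v \<otimes>\<^bsub>form_alg K P \<theta>'\<^esub> f w)"
        by (simp add: form_alg_proj v(2) [symmetric] w(2) [symmetric])
      also have "\<dots> = snd (f (\<zero>\<^bsub>P\<^esub>, \<zero>\<^bsub>K\<^esub>))"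
        using alg_homD(5) [OF f(1), of v w] v(1) w(1) vw by simp
      also have "f (\<zero>\<^bsub>P\<^esub>, \<zero>\<^bsub>K\<^esub>) = (\<zero>\<^bsub>P\<^esub>, \<zero>\<^bsub>K\<^esub>)"
        using module_hom_zero [OF _ _ alg_homD(1) [OF f(1)]]
          form_alg_assoc_algebra [OF \<theta>] form_alg_assoc_algebra [OF \<theta>']
        by (simp add: assoc_algebra_def vectorspace_def)
      finally show ?thesis by simp
    qed
    then have "\<forall>p\<in>carrier P. \<forall>q\<in>carrier P.
        \<one>\<^bsub>K\<^esub> \<otimes>\<^bsub>K\<^esub> \<theta> p q = \<theta>' ((\<lambda>p\<in>carrier P. p) p) ((\<lambda>p\<in>carrier P. p) q)"
      using False by simp
    with lin_aut_id show ?thesis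
      unfolding homothetic_def by (metis DiffI R.one_closed one_not_zero singletonD)
  qed
next
  assume "homothetic K P \<theta> \<theta>'"
  then obtain u \<psi> where u: "u \<in> carrier K" "u \<noteq> \<zero>\<^bsub>K\<^esub>" and \<psi>: "\<psi> \<in> lin_aut K P"
    and eq: "\<And>p q. p \<in> carrier P \<Longrightarrow> q \<in> carrier P \<Longrightarrow> u \<otimes>\<^bsub>K\<^esub> \<theta> p q = \<theta>' (\<psi> p) (\<psi> q)"
    by (auto simp: homothetic_def)
  note t = triangular_alg_hom [OF \<theta> u(1) zero_dual_space \<psi> eq] triangular_Bij [OF u zero_dual_space \<psi>]
  then show "alg_isomorphic K (form_alg K P \<theta>) (form_alg K P \<theta>')"
    unfolding alg_isomorphic_def by (auto simp: Bij_def)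
qed

text \<open>Write \<open>u = v\<^sup>2\<close> and rescale \<open>\<psi>\<close> by the inverse
  \<open>w\<close> of \<open>v\<close>: bilinearity of \<open>\<theta>'\<close> contributes
  \<open>w\<^sup>2\<close>, which cancels \<open>u\<close>. Conversely, an isometry is a homothety
  with \<open>u = 1\<close>.\<close>

lemma homothetic_iff_isometric:
  assumes \<theta>: "\<theta> \<in> Bil K P" and \<theta>': "\<theta>' \<in> Bil K P"
    and squares: "carrier K = {x \<otimes>\<^bsub>K\<^esub> x | x. x \<in> carrier K}"
  shows "homothetic K P \<theta> \<theta>' \<longleftrightarrow> isometric K P \<theta> \<theta>'"
proof
  assume "homothetic K P \<theta> \<theta>'"
  then obtain u \<psi> where u: "u \<in> carrier K" "u \<noteq> \<zero>\<^bsub>K\<^esub>" and \<psi>: "\<psi> \<in> lin_aut K P"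
    and eq: "\<And>p q. p \<in> carrier P \<Longrightarrow> q \<in> carrier P \<Longrightarrow> u \<otimes>\<^bsub>K\<^esub> \<theta> p q = \<theta>' (\<psi> p) (\<psi> q)"
    by (auto simp: homothetic_def)
  obtain v where v: "v \<in> carrier K" "u = v \<otimes>\<^bsub>K\<^esub> v"
    using u(1) squares by blast
  then have v0: "v \<noteq> \<zero>\<^bsub>K\<^esub>" using u by auto
  define w where "w = inv\<^bsub>K\<^esub> v"
  have w: "w \<in> carrier K" "w \<otimes>\<^bsub>K\<^esub> v = \<one>\<^bsub>K\<^esub>" "v \<otimes>\<^bsub>K\<^esub> w = \<one>\<^bsub>K\<^esub>"
    using v v0 by (auto simp: w_def field_Units)
  note h = lin_autD(4) [OF \<psi>] module_hom_add [OF lin_autD(1) [OF \<psi>]]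
      module_hom_smult [OF lin_autD(1) [OF \<psi>]]
  have cancel: "w \<odot>\<^bsub>P\<^esub> (v \<odot>\<^bsub>P\<^esub> p) = p" "v \<odot>\<^bsub>P\<^esub> (w \<odot>\<^bsub>P\<^esub> p) = p" if "p \<in> carrier P" for p
    using that v w by (simp_all add: smult_assoc1 [symmetric])
  define \<phi> where "\<phi> = (\<lambda>p\<in>carrier P. w \<odot>\<^bsub>P\<^esub> \<psi> p)"
  have "\<phi> \<in> module_hom K P P"
    by (rule module_homI)
      (simp_all add: \<phi>_def h w smult_r_distr smult_assoc1 [symmetric] R.m_comm)
  moreover have "bij_betw (\<lambda>p. w \<odot>\<^bsub>P\<^esub> p) (carrier P) (carrier P)"
    by (rule bij_betw_byWitness [where f' = "\<lambda>p. v \<odot>\<^bsub>P\<^esub> p"]) (use cancel v w in auto)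
  from bij_betw_trans [OF lin_autD(2) [OF \<psi>] this]
  have "bij_betw \<phi> (carrier P) (carrier P)"
    by (rule bij_betw_cong [THEN iffD1, rotated]) (simp add: \<phi>_def)
  ultimately have "\<phi> \<in> lin_aut K P"
    by (simp add: lin_aut_def Bij_def \<phi>_def)
  moreover have "\<theta> p q = \<theta>' (\<phi> p) (\<phi> q)" if pq: "p \<in> carrier P" "q \<in> carrier P" for p q
  proof -
    have "\<theta>' (\<phi> p) (\<phi> q) = w \<otimes>\<^bsub>K\<^esub> (w \<otimes>\<^bsub>K\<^esub> (v \<otimes>\<^bsub>K\<^esub> v \<otimes>\<^bsub>K\<^esub> \<theta> p q))"
      using pq w h(1) eq [OF pq] by (simp add: \<phi>_def BilD [OF \<theta>'] v(2))
    also have "\<dots> = (w \<otimes>\<^bsub>K\<^esub> v) \<otimes>\<^bsub>K\<^esub> (w \<otimes>\<^bsub>K\<^esub> v) \<otimes>\<^bsub>K\<^esub> \<theta> p q"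
      using w(1) v(1) BilD(1) [OF \<theta> pq] by (simp add: R.m_ac)
    finally show ?thesis
      using w(2) BilD(1) [OF \<theta> pq] by simp
  qed
  ultimately show "isometric K P \<theta> \<theta>'"
    unfolding isometric_def by blast
next
  assume "isometric K P \<theta> \<theta>'"
  then obtain \<phi> where \<phi>: "\<phi> \<in> lin_aut K P"
      "\<forall>p\<in>carrier P. \<forall>q\<in>carrier P. \<theta> p q = \<theta>' (\<phi> p) (\<phi> q)"
    unfolding isometric_def by blast
  then have "\<forall>p\<in>carrier P. \<forall>q\<in>carrier P. \<one>\<^bsub>K\<^esub> \<otimes>\<^bsub>K\<^esub> \<theta> p q = \<theta>' (\<phi> p) (\<phi> q)"
    using BilD(1) [OF \<theta>] by (metis R.l_one)
  then show "homothetic K P \<theta> \<theta>'"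
    using \<phi>(1) unfolding homothetic_def by (metis DiffI R.one_closed one_not_zero singletonD)
qed

end

section \<open>Automorphism groups\<close>

context vspace
begin

lemma lin_aut_compose:
  assumes "\<psi> \<in> lin_aut K P" "\<psi>' \<in> lin_aut K P"
  shows "compose (carrier P) \<psi> \<psi>' \<in> lin_aut K P"
proof -
  note h = lin_autD [OF assms(1)] and h' = lin_autD [OF assms(2)]
  have "compose (carrier P) \<psi> \<psi>' \<in> module_hom K P P"
    by (rule module_homI)
      (simp_all add: compose_eq h(4) h'(4) module_hom_add [OF h(1)] module_hom_add [OF h'(1)]
        module_hom_smult [OF h(1)] module_hom_smult [OF h'(1)])
  moreover have "compose (carrier P) \<psi> \<psi>' \<in> Bij (carrier P)"
    using assms by (intro compose_Bij) (simp_all add: lin_aut_def)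
  ultimately show ?thesis by (simp add: lin_aut_def)
qed

lemma lin_aut_inverse:
  assumes "\<psi> \<in> lin_aut K P"
  shows "restrict (inv_into (carrier P) \<psi>) (carrier P) \<in> lin_aut K P"
proof -
  have "inv_into (carrier P) \<psi> \<in> module_hom K P P"
    by (rule module_hom_inv_into [OF module_axioms lin_autD(1,2) [OF assms]])
  then have "restrict (inv_into (carrier P) \<psi>) (carrier P) \<in> module_hom K P P"
    by (auto simp: module_hom_def)
  moreover have "restrict (inv_into (carrier P) \<psi>) (carrier P) \<in> Bij (carrier P)"
    using assms by (intro restrict_inv_into_Bij) (simp add: lin_aut_def)
  ultimately show ?thesis by (simp add: lin_aut_def)
qed

section \<open>The group of triples \<open>(u, \<lambda>, \<psi>)\<close>\<close>

lemma form_group_carrierD: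
  assumes "(u, l, \<psi>) \<in> carrier (form_group K P \<theta>)"
  shows "u \<in> carrier K" "u \<noteq> \<zero>\<^bsub>K\<^esub>" "l \<in> dual_space K P" "\<psi> \<in> lin_aut K P"
    "p \<in> carrier P \<Longrightarrow> q \<in> carrier P \<Longrightarrow> u \<otimes>\<^bsub>K\<^esub> \<theta> p q = \<theta> (\<psi> p) (\<psi> q)"
  using assms by (auto simp: form_group_def)

lemma form_group_carrierI:
  assumes "u \<in> carrier K" "u \<noteq> \<zero>\<^bsub>K\<^esub>" "l \<in> dual_space K P" "\<psi> \<in> lin_aut K P"
    "\<And>p q. p \<in> carrier P \<Longrightarrow> q \<in> carrier P \<Longrightarrow> u \<otimes>\<^bsub>K\<^esub> \<theta> p q = \<theta> (\<psi> p) (\<psi> q)"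
  shows "(u, l, \<psi>) \<in> carrier (form_group K P \<theta>)"
  using assms by (auto simp: form_group_def)

lemma form_group_mult:
  "(u, l, \<psi>) \<otimes>\<^bsub>form_group K P \<theta>\<^esub> (u', l', \<psi>') =
    (u \<otimes>\<^bsub>K\<^esub> u', \<lambda>p\<in>carrier P. l (\<psi>' p) \<oplus>\<^bsub>K\<^esub> u \<otimes>\<^bsub>K\<^esub> l' p, compose (carrier P) \<psi> \<psi>')"
  by (simp add: form_group_def)

lemma form_group_one:
  "\<one>\<^bsub>form_group K P \<theta>\<^esub> = (\<one>\<^bsub>K\<^esub>, \<lambda>p\<in>carrier P. \<zero>\<^bsub>K\<^esub>, \<lambda>p\<in>carrier P. p)"
  by (simp add: form_group_def)

lemma form_group_m_closed:
  assumes \<theta>: "\<theta> \<in> Bil K P"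
    and a: "(u, l, \<psi>) \<in> carrier (form_group K P \<theta>)" and b: "(u', l', \<psi>') \<in> carrier (form_group K P \<theta>)"
  shows "(u, l, \<psi>) \<otimes>\<^bsub>form_group K P \<theta>\<^esub> (u', l', \<psi>') \<in> carrier (form_group K P \<theta>)"
  unfolding form_group_mult
proof (rule form_group_carrierI)
  note a = form_group_carrierD [OF a] and b = form_group_carrierD [OF b]
  note d = dual_spaceD [OF a(3)] dual_spaceD [OF b(3)] and h = lin_autD [OF a(4)] lin_autD [OF b(4)]
  note hom = module_hom_add [OF lin_autD(1) [OF b(4)]] module_hom_smult [OF lin_autD(1) [OF b(4)]]
  show "u \<otimes>\<^bsub>K\<^esub> u' \<in> carrier K" using a b by simp
  show "u \<otimes>\<^bsub>K\<^esub> u' \<noteq> \<zero>\<^bsub>K\<^esub>" using a(1,2) b(1,2) integral by blast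
  show "(\<lambda>p\<in>carrier P. l (\<psi>' p) \<oplus>\<^bsub>K\<^esub> u \<otimes>\<^bsub>K\<^esub> l' p) \<in> dual_space K P"
    unfolding dual_space_def using a(1)
    by (intro IntI module_homI)
      (simp_all add: d h hom R.r_distr R.a_ac R.m_ac)
  show "compose (carrier P) \<psi> \<psi>' \<in> lin_aut K P"
    using a(4) b(4) by (rule lin_aut_compose)
  show "u \<otimes>\<^bsub>K\<^esub> u' \<otimes>\<^bsub>K\<^esub> \<theta> p q = \<theta> (compose (carrier P) \<psi> \<psi>' p) (compose (carrier P) \<psi> \<psi>' q)"
    if "p \<in> carrier P" "q \<in> carrier P" for p q
    using that a(1) b(1) h(8) BilD(1) [OF \<theta>]
    by (simp add: compose_eq a(5) [symmetric] b(5) [symmetric] R.m_assoc)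
qed

text \<open>The axioms are verified from the formulas for every bilinear form, including the zero
  form, for which triangular maps may be only part of the automorphisms. It suffices to give a left
  unit and left inverses.\<close>

lemma group_form_group:
  assumes \<theta>: "\<theta> \<in> Bil K P"
  shows "group (form_group K P \<theta>)"
proof (rule groupI)
  show "a \<otimes>\<^bsub>form_group K P \<theta>\<^esub> b \<in> carrier (form_group K P \<theta>)"
    if "a \<in> carrier (form_group K P \<theta>)" "b \<in> carrier (form_group K P \<theta>)" for a b
    using that by (cases a; cases b) (auto intro: form_group_m_closed [OF \<theta>])
  show "\<one>\<^bsub>form_group K P \<theta>\<^esub> \<in> carrier (form_group K P \<theta>)"
    unfolding form_group_one
    by (intro form_group_carrierI lin_aut_id zero_dual_space) (simp_all add: BilD(1) [OF \<theta>])
next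
  fix a b c
  assume "a \<in> carrier (form_group K P \<theta>)" "b \<in> carrier (form_group K P \<theta>)" "c \<in> carrier (form_group K P \<theta>)"
  moreover obtain u l \<psi> u' l' \<psi>' v m \<chi> where abc: "a = (u, l, \<psi>)" "b = (u', l', \<psi>')" "c = (v, m, \<chi>)"
    by (metis prod_cases3)
  ultimately have a: "(u, l, \<psi>) \<in> carrier (form_group K P \<theta>)"
    and b: "(u', l', \<psi>') \<in> carrier (form_group K P \<theta>)" and c: "(v, m, \<chi>) \<in> carrier (form_group K P \<theta>)"
    by auto
  note a = form_group_carrierD [OF a] and b = form_group_carrierD [OF b] and c = form_group_carrierD [OF c]
  note d = dual_spaceD(3) [OF a(3)] dual_spaceD(3) [OF b(3)] dual_spaceD(3) [OF c(3)]
    and h = lin_autD(4) [OF a(4)] lin_autD(4) [OF b(4)] lin_autD(4) [OF c(4)]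
  have "compose (carrier P) (compose (carrier P) \<psi> \<psi>') \<chi> =
      compose (carrier P) \<psi> (compose (carrier P) \<psi>' \<chi>)"
    using h by (auto simp: compose_def fun_eq_iff)
  then show "a \<otimes>\<^bsub>form_group K P \<theta>\<^esub> b \<otimes>\<^bsub>form_group K P \<theta>\<^esub> c =
      a \<otimes>\<^bsub>form_group K P \<theta>\<^esub> (b \<otimes>\<^bsub>form_group K P \<theta>\<^esub> c)"
    using a(1) b(1) c(1) d h
    by (auto simp: abc form_group_mult R.m_assoc R.a_assoc R.r_distr compose_eq intro!: restrict_ext)
next
  fix a assume "a \<in> carrier (form_group K P \<theta>)"
  moreover obtain u l \<psi> where a_def: "a = (u, l, \<psi>)" by (metis prod_cases3)
  ultimately have a: "(u, l, \<psi>) \<in> carrier (form_group K P \<theta>)" by simp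
  note a = form_group_carrierD [OF a]
  note d = dual_spaceD [OF a(3)] and h = lin_autD [OF a(4)]
  have "(\<lambda>p\<in>carrier P. (\<lambda>q\<in>carrier P. \<zero>\<^bsub>K\<^esub>) (\<psi> p) \<oplus>\<^bsub>K\<^esub> \<one>\<^bsub>K\<^esub> \<otimes>\<^bsub>K\<^esub> l p) = l"
    by (rule extensionalityI [OF restrict_extensional d(2)]) (simp add: d(3) h(4))
  moreover have "compose (carrier P) (\<lambda>p\<in>carrier P. p) \<psi> = \<psi>"
    by (rule extensionalityI [OF compose_extensional h(3)]) (simp add: compose_eq h(4))
  ultimately show "\<one>\<^bsub>form_group K P \<theta>\<^esub> \<otimes>\<^bsub>form_group K P \<theta>\<^esub> a = a"
    using a(1) by (simp add: a_def form_group_mult form_group_one)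
  have iu: "inv\<^bsub>K\<^esub> u \<in> carrier K" "inv\<^bsub>K\<^esub> u \<otimes>\<^bsub>K\<^esub> u = \<one>\<^bsub>K\<^esub>"
    using a(1,2) by (auto simp: field_Units)
  have iu0: "inv\<^bsub>K\<^esub> u \<noteq> \<zero>\<^bsub>K\<^esub>"
    using iu a(1) by auto
  define g where "g = restrict (inv_into (carrier P) \<psi>) (carrier P)"
  have g: "g \<in> lin_aut K P"
    unfolding g_def by (rule lin_aut_inverse [OF a(4)])
  note g_in = lin_autD(4) [OF g]
  have \<psi>g: "\<psi> (g p) = p" if "p \<in> carrier P" for p
    using that h(2) by (simp add: g_def bij_betw_inv_into_right)
  have g\<psi>: "g (\<psi> p) = p" if "p \<in> carrier P" for p
    using that h(2,4) by (simp add: g_def bij_betw_inv_into_left)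
  \<comment> \<open>The functional of the left inverse must satisfy
    \<open>m (\<psi> p) + inv u * l p = 0\<close>; substituting \<open>g p\<close> for
    \<open>p\<close> gives this formula.\<close>
  define m where "m = (\<lambda>p\<in>carrier P. \<ominus>\<^bsub>K\<^esub> (inv\<^bsub>K\<^esub> u \<otimes>\<^bsub>K\<^esub> l (g p)))"
  have "m \<in> dual_space K P"
    unfolding dual_space_def m_def using iu(1)
    by (intro IntI module_homI)
      (simp_all add: d g_in module_hom_add [OF lin_autD(1) [OF g]] module_hom_smult [OF lin_autD(1) [OF g]]
        R.r_distr R.minus_add R.m_lcomm R.r_minus)
  then have b: "(inv\<^bsub>K\<^esub> u, m, g) \<in> carrier (form_group K P \<theta>)"
  proof (rule form_group_carrierI [OF iu(1) iu0 _ g])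
    fix p q assume pq: "p \<in> carrier P" "q \<in> carrier P"
    \<comment> \<open>The condition on the inverse triple is the one for \<open>\<psi>\<close> at
      the arguments \<open>g p\<close> and \<open>g q\<close>, divided by \<open>u\<close>.\<close>
    have "\<theta> p q = u \<otimes>\<^bsub>K\<^esub> \<theta> (g p) (g q)"
      using a(5) [of "g p" "g q"] pq by (simp add: g_in \<psi>g)
    then show "inv\<^bsub>K\<^esub> u \<otimes>\<^bsub>K\<^esub> \<theta> p q = \<theta> (g p) (g q)"
      using iu a(1) pq BilD(1) [OF \<theta>] g_in by (simp add: R.m_assoc [symmetric])
  qed
  have "(\<lambda>p\<in>carrier P. m (\<psi> p) \<oplus>\<^bsub>K\<^esub> inv\<^bsub>K\<^esub> u \<otimes>\<^bsub>K\<^esub> l p) = (\<lambda>p\<in>carrier P. \<zero>\<^bsub>K\<^esub>)"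
    using iu(1) d(3) h(4) by (intro restrict_ext) (simp add: m_def g\<psi> R.l_neg)
  moreover have "compose (carrier P) g \<psi> = (\<lambda>p\<in>carrier P. p)"
    by (auto simp: compose_def g\<psi> fun_eq_iff)
  ultimately have "(inv\<^bsub>K\<^esub> u, m, g) \<otimes>\<^bsub>form_group K P \<theta>\<^esub> a = \<one>\<^bsub>form_group K P \<theta>\<^esub>"
    using iu by (simp add: a_def form_group_mult form_group_one)
  with b show "\<exists>b\<in>carrier (form_group K P \<theta>). b \<otimes>\<^bsub>form_group K P \<theta>\<^esub> a = \<one>\<^bsub>form_group K P \<theta>\<^esub>"
    by blast
qed

section \<open>The isomorphism with the automorphism group\<close>

lemma triangular_in_AlgAut:
  assumes \<theta>: "\<theta> \<in> Bil K P" and a: "(u, l, \<psi>) \<in> carrier (form_group K P \<theta>)"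
  shows "triangular (u, l, \<psi>) \<in> carrier (AlgAut K (form_alg K P \<theta>))"
  using form_group_carrierD [OF a]
  by (simp add: AlgAut_def triangular_Bij triangular_alg_hom [OF \<theta>])

text \<open>This is where the group law comes from: inserting
  \<open>(\<psi>' p, l' p + u' x)\<close> into the outer map gives the second component
  \<open>l (\<psi>' p) + u l' p + u u' x\<close>.\<close>

lemma triangular_mult:
  assumes \<theta>: "\<theta> \<in> Bil K P" and a: "(u, l, \<psi>) \<in> carrier (form_group K P \<theta>)"
    and b: "(u', l', \<psi>') \<in> carrier (form_group K P \<theta>)"
  shows "triangular ((u, l, \<psi>) \<otimes>\<^bsub>form_group K P \<theta>\<^esub> (u', l', \<psi>')) =
    triangular (u, l, \<psi>) \<otimes>\<^bsub>AlgAut K (form_alg K P \<theta>)\<^esub> triangular (u', l', \<psi>')"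
proof -
  note A = form_group_carrierD [OF a] and B = form_group_carrierD [OF b]
  have "triangular (u, l, \<psi>) \<otimes>\<^bsub>AlgAut K (form_alg K P \<theta>)\<^esub> triangular (u', l', \<psi>') =
      compose (carrier P \<times> carrier K) (triangular (u, l, \<psi>)) (triangular (u', l', \<psi>'))"
    using triangular_Bij [OF A(1-4)] triangular_Bij [OF B(1-4)] by (simp add: AlgAut_def BijGroup_def)
  also have "\<dots> = triangular ((u, l, \<psi>) \<otimes>\<^bsub>form_group K P \<theta>\<^esub> (u', l', \<psi>'))"
  proof (rule extensionalityI)
    show "compose (carrier P \<times> carrier K) (triangular (u, l, \<psi>)) (triangular (u', l', \<psi>')) v =
        triangular ((u, l, \<psi>) \<otimes>\<^bsub>form_group K P \<theta>\<^esub> (u', l', \<psi>')) v" if "v \<in> carrier P \<times> carrier K" for v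
      using that A(1) B(1) dual_spaceD(3) [OF A(3)] dual_spaceD(3) [OF B(3)]
        lin_autD(4) [OF A(4)] lin_autD(4) [OF B(4)]
      by (auto simp: compose_eq triangular_apply form_group_mult R.r_distr R.a_assoc R.m_assoc)
  qed (simp_all add: triangular_def form_group_mult)
  finally show ?thesis by simp
qed

text \<open>The isomorphism is \<open>triangular\<close>, read backwards. Its surjectivity is what
  \<open>nondeg\<close> secures: for the zero form every linear bijection of
  \<open>P \<times> k\<close> is an automorphism, and when \<open>P\<close> is nonzero some of these
  are not triangular.\<close>

lemma AlgAut_iso_form_group:
  assumes \<theta>: "\<theta> \<in> Bil K P"
    and nondeg: "(\<exists>p\<in>carrier P. \<exists>q\<in>carrier P. \<theta> p q \<noteq> \<zero>\<^bsub>K\<^esub>) \<or> carrier P = {\<zero>\<^bsub>P\<^esub>}"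
  shows "AlgAut K (form_alg K P \<theta>) \<cong> form_group K P \<theta>"
proof -
  let ?G = "form_group K P \<theta>" and ?H = "AlgAut K (form_alg K P \<theta>)"
  have "triangular \<in> hom ?G ?H"
    using triangular_in_AlgAut [OF \<theta>] triangular_mult [OF \<theta>]
    by (intro homI) (metis prod_cases3)+
  moreover have "inj_on triangular (carrier ?G)"
  proof (rule inj_onI)
    fix a b assume "a \<in> carrier ?G" "b \<in> carrier ?G" and eq: "triangular a = triangular b"
    moreover obtain u l \<psi> u' l' \<psi>' where ab: "a = (u, l, \<psi>)" "b = (u', l', \<psi>')"
      by (metis prod_cases3)
    ultimately have a: "(u, l, \<psi>) \<in> carrier ?G" and b: "(u', l', \<psi>') \<in> carrier ?G"
      by auto
    note A = form_group_carrierD [OF a] and B = form_group_carrierD [OF b]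
    have at: "triangular (u, l, \<psi>) (p, x) = triangular (u', l', \<psi>') (p, x)" for p x
      using eq ab by simp
    \<comment> \<open>Evaluation at \<open>(p, 0)\<close> recovers \<open>\<psi>\<close> and
      \<open>l\<close>; evaluation at \<open>(0, 1)\<close> will recover \<open>u\<close>.\<close>
    have at0: "\<psi> p = \<psi>' p" "l p = l' p" if "p \<in> carrier P" for p
      using that at [of p "\<zero>\<^bsub>K\<^esub>"] A(1) B(1) dual_spaceD(3) [OF A(3)] dual_spaceD(3) [OF B(3)]
      by (simp_all add: triangular_apply)
    have "\<psi> = \<psi>'"
      by (rule extensionalityI [OF lin_autD(3) [OF A(4)] lin_autD(3) [OF B(4)] at0(1)])
    moreover have "l = l'"
      by (rule extensionalityI [OF dual_spaceD(2) [OF A(3)] dual_spaceD(2) [OF B(3)] at0(2)])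
    moreover have "u = u'"
      using at [of "\<zero>\<^bsub>P\<^esub>" "\<one>\<^bsub>K\<^esub>"] A(1) B(1)
      by (simp add: triangular_apply dual_space_zero [OF A(3)] dual_space_zero [OF B(3)])
    ultimately show "a = b" by (simp add: ab)
  qed
  moreover have "\<exists>a\<in>carrier ?G. triangular a = f" if f: "f \<in> carrier ?H" for f
  proof -
    have f: "f \<in> alg_hom K (form_alg K P \<theta>) (form_alg K P \<theta>)"
      "bij_betw f (carrier P \<times> carrier K) (carrier P \<times> carrier K)" "f \<in> extensional (carrier P \<times> carrier K)"
      using f by (auto simp: AlgAut_def Bij_def)
    obtain u l \<psi> where *: "u \<in> carrier K - {\<zero>\<^bsub>K\<^esub>}" "l \<in> dual_space K P" "\<psi> \<in> lin_aut K P"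
      "\<And>p q. p \<in> carrier P \<Longrightarrow> q \<in> carrier P \<Longrightarrow> u \<otimes>\<^bsub>K\<^esub> \<theta> p q = \<theta> (\<psi> p) (\<psi> q)"
      "\<And>v. v \<in> carrier P \<times> carrier K \<Longrightarrow> f v = triangular (u, l, \<psi>) v"
      using form_alg_iso_triangular [OF \<theta> \<theta> f(1,2) nondeg] by metis
    have "triangular (u, l, \<psi>) = f"
      by (rule extensionalityI [OF _ f(3)]) (simp_all add: *(5) triangular_def)
    moreover have "(u, l, \<psi>) \<in> carrier ?G"
      using * by (intro form_group_carrierI) auto
    ultimately show ?thesis by blast
  qed
  then have "carrier ?H \<subseteq> triangular ` carrier ?G" by blast
  ultimately have "triangular \<in> iso ?G ?H"
    by (auto simp: iso_def bij_betw_def hom_def)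
  then have "?G \<cong> ?H" by (rule is_isoI)
  then show ?thesis
    by (rule group.iso_sym [OF group_form_group [OF \<theta>]])
qed

end

theorem theorem2p8:
  fixes K :: "('k, 'm) ring_scheme" and P :: "('k, 'p) module"
  assumes "field K" and "vectorspace K P"
  shows
    "((\<forall>\<theta>\<in>Bil K P.
         is_extension K (abelian_alg P) (abelian_alg (field_space K)) (form_ext K P \<theta>)) \<and>
      bij_betw
        (\<lambda>\<theta>. ext_rel K (abelian_alg P) (abelian_alg (field_space K)) `` {form_ext K P \<theta>})
        (Bil K P)
        (Ext K (abelian_alg P) (abelian_alg (field_space K))) \<and>
      (\<forall>(A :: ('k, 'a) module) i \<pi>.
         is_extension K (abelian_alg P) (abelian_alg (field_space K)) (A, i, \<pi>) \<longrightarrow>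
         (\<exists>!\<theta>. \<theta> \<in> Bil K P \<and>
            ext_equivalent K (abelian_alg (field_space K)) (form_ext K P \<theta>) (A, i, \<pi>))) \<and>
      (\<forall>A :: ('k, 'a) module.
         assoc_algebra K A \<and> metabelian K A \<and>
         vectorspace.fin_dim K (A\<lparr>carrier := derived_algebra K A\<rparr>) \<and>
         vectorspace.dim K (A\<lparr>carrier := derived_algebra K A\<rparr>) = 1 \<longrightarrow>
         (\<exists>(Q :: ('k, 'a) module) \<theta>.
            vectorspace K Q \<and> \<theta> \<in> Bil K Q \<and> alg_isomorphic K A (form_alg K Q \<theta>)))) \<and>
     ((\<forall>\<theta>\<in>Bil K P. \<forall>\<theta>'\<in>Bil K P.
         alg_isomorphic K (form_alg K P \<theta>) (form_alg K P \<theta>') \<longleftrightarrow> homothetic K P \<theta> \<theta>') \<and>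
      (carrier K = {x \<otimes>\<^bsub>K\<^esub> x | x. x \<in> carrier K} \<longrightarrow>
       (\<forall>\<theta>\<in>Bil K P. \<forall>\<theta>'\<in>Bil K P.
          alg_isomorphic K (form_alg K P \<theta>) (form_alg K P \<theta>') \<longleftrightarrow> isometric K P \<theta> \<theta>'))) \<and>
     ((\<forall>\<theta>\<in>Bil K P. group (form_group K P \<theta>)) \<and>
      (\<forall>\<theta>\<in>Bil K P.
         (\<exists>p\<in>carrier P. \<exists>q\<in>carrier P. \<theta> p q \<noteq> \<zero>\<^bsub>K\<^esub>) \<or> carrier P = {\<zero>\<^bsub>P\<^esub>} \<longrightarrow>
         AlgAut K (form_alg K P \<theta>) \<cong> form_group K P \<theta>))"
proof -
  interpret P: vspace K P
    using assms(2) by (rule vspace.intro)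
  let ?W = "abelian_alg (field_space K)"
  have "\<exists>!\<theta>. \<theta> \<in> Bil K P \<and> ext_equivalent K ?W (form_ext K P \<theta>) (A, i, \<pi>)"
    if "is_extension K (abelian_alg P) ?W (A, i, \<pi>)" for A :: "('k, 'a) module" and i \<pi>
    using P.extension_form_exists [OF that] P.extension_form_unique [OF that] by blast
  moreover have "\<exists>(Q :: ('k, 'a) module) \<theta>.
      vectorspace K Q \<and> \<theta> \<in> Bil K Q \<and> alg_isomorphic K A (form_alg K Q \<theta>)"
    if "assoc_algebra K A \<and> metabelian K A \<and>
      vectorspace.fin_dim K (A\<lparr>carrier := derived_algebra K A\<rparr>) \<and>
      vectorspace.dim K (A\<lparr>carrier := derived_algebra K A\<rparr>) = 1" for A :: "('k, 'a) module"
    using that by (intro metabelian_derived_dim_1) auto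
  moreover have "alg_isomorphic K (form_alg K P \<theta>) (form_alg K P \<theta>') \<longleftrightarrow> isometric K P \<theta> \<theta>'"
    if "carrier K = {x \<otimes>\<^bsub>K\<^esub> x | x. x \<in> carrier K}" "\<theta> \<in> Bil K P" "\<theta>' \<in> Bil K P" for \<theta> \<theta>'
    using P.alg_isomorphic_iff_homothetic [OF that(2,3)]
      P.homothetic_iff_isometric [OF that(2,3,1)] by simp
  ultimately show ?thesis
    using P.form_ext_is_extension P.bij_betw_Bil_Ext P.alg_isomorphic_iff_homothetic
      P.group_form_group P.AlgAut_iso_form_group
    by (intro conjI allI ballI impI) assumption+
qed

end
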